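(* Let $I\subset S=K[x_1,\ldots,x_n]$ be a nonzero proper monomial ideal of Borel type and let $q$ be a positive integer. Then $$\operatorname{reg}(I^{[q]}) \leq q\operatorname{reg}(I) + (q-1)(n-1) = \alpha q \operatorname{reg}(I) - (n-1),$$ where $\alpha=1+\frac{n-1}{\operatorname{reg}(I)}$ and $I^{[q]}$ is the $q$-th bracket power of $I$.
   Context: $K$ is an infinite field and $S=K[x_1,\ldots,x_n]$, $n\geq 2$, is the polynomial ring with the standard grading. Borel type: a monomial ideal $I\subset S$ is of Borel type if $(I:x_j^\infty)=(I:(x_1,\ldots,x_j)^\infty)$ for all $j=1,\ldots,n$, where $(I:J^\infty)=\bigcup_{k\ge 0}(I:J^k)$. Bracket power: for a monomial ideal $I$, $I^{[q]}$ is the ideal generated by all $u^q$ with $u\in I$ a monomial. Regularity: for a finitely generated graded $S$-module $M$, $\operatorname{reg}(M)=\max_{i,j}\{j-i:\beta_{ij}(M)\neq 0\}$, where $\beta_{ij}(M)=\dim_K \operatorname{Tor}_i^S(K,M)_j$. Here $\operatorname{reg}(I)$ is the regularity of the ideal $I$ as an $S$-module. *)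

theory Defs
  imports Complex_Main
    "HOL-Library.Cardinality" "HOL-Library.Poly_Mapping" "HOL-Library.Function_Algebras"
begin

text \<open>
  The polynomial ring \<open>S = K[x\<^sub>1, \<dots>, x\<^sub>n]\<close> is the whole type \<open>('n, 'k) mpoly\<close>, with the convolution
  product of \<open>HOL-Library.Poly_Mapping\<close>; the variables are indexed by a finite linearly ordered type
  \<open>'n\<close> with \<open>n = CARD('n)\<close>, so that \<open>x\<^sub>1, \<dots>, x\<^sub>j\<close> are the variables with index at most \<open>j\<close>.
\<close>

type_synonym ('n, 'k) mpoly = "('n \<Rightarrow>\<^sub>0 nat) \<Rightarrow>\<^sub>0 'k"

definition var :: "'n \<Rightarrow> ('n, 'k::comm_ring_1) mpoly"
  where "var i = Poly_Mapping.single (Poly_Mapping.single i 1) 1"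

definition is_monomial :: "('n, 'k::comm_ring_1) mpoly \<Rightarrow> bool"
  where "is_monomial u \<longleftrightarrow> (\<exists>a. u = Poly_Mapping.single a 1)"

definition total_degree :: "('n::finite \<Rightarrow>\<^sub>0 nat) \<Rightarrow> nat"
  where "total_degree a = (\<Sum>i\<in>UNIV. Poly_Mapping.lookup a i)"

definition homogeneous_part :: "int \<Rightarrow> ('n::finite, 'k::comm_ring_1) mpoly set"
  where "homogeneous_part d = {f. \<forall>a\<in>Poly_Mapping.keys f. int (total_degree a) = d}"


section \<open>Ideals\<close>

text \<open>Ideals are the subspaces of a commutative ring regarded as a module over itself, and
  \<open>ring_module.span B\<close> is the ideal generated by \<open>B\<close>.\<close>

interpretation ring_module: module "(*) :: 'a::comm_ring_1 \<Rightarrow> 'a \<Rightarrow> 'a"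
  by standard (simp_all add: algebra_simps)

definition monomial_ideal :: "('n, 'k::comm_ring_1) mpoly set \<Rightarrow> bool"
  where "monomial_ideal I \<longleftrightarrow> (\<exists>U. (\<forall>u\<in>U. is_monomial u) \<and> I = ring_module.span U)"

definition ideal_mult :: "'a::comm_ring_1 set \<Rightarrow> 'a set \<Rightarrow> 'a set"
  where "ideal_mult I J = ring_module.span {a * b | a b. a \<in> I \<and> b \<in> J}"

primrec ideal_power :: "'a::comm_ring_1 set \<Rightarrow> nat \<Rightarrow> 'a set"
  where
    "ideal_power J 0 = UNIV"
  | "ideal_power J (Suc k) = ideal_mult J (ideal_power J k)"

definition ideal_colon :: "'a::comm_ring_1 set \<Rightarrow> 'a set \<Rightarrow> 'a set"
  where "ideal_colon I J = {f. \<forall>g\<in>J. f * g \<in> I}"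

definition saturation :: "'a::comm_ring_1 set \<Rightarrow> 'a set \<Rightarrow> 'a set"
  where "saturation I J = (\<Union>k. ideal_colon I (ideal_power J k))"

definition borel_type :: "('n::{finite,linorder}, 'k::comm_ring_1) mpoly set \<Rightarrow> bool"
  where "borel_type I \<longleftrightarrow>
    (\<forall>j. saturation I (ring_module.span {var j}) = saturation I (ring_module.span (var ` {..j})))"

definition bracket_power :: "('n, 'k::comm_ring_1) mpoly set \<Rightarrow> nat \<Rightarrow> ('n, 'k) mpoly set"
  where "bracket_power I q = ring_module.span {u ^ q | u. u \<in> I \<and> is_monomial u}"


section \<open>Graded free resolutions of the residue field\<close>

text \<open>
  A complex \<open>\<dots> \<rightarrow> P\<^sub>2 \<rightarrow> P\<^sub>1 \<rightarrow> P\<^sub>0 \<rightarrow> K \<rightarrow> 0\<close> with each \<open>P\<^sub>i\<close> graded free of finite rank. The module \<open>P\<^sub>i\<close>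
  has a homogeneous basis of elements \<open>e\<^sub>k\<close>, \<open>k < rank P i\<close>, with \<open>e\<^sub>k\<close> of degree \<open>gen_degree P i k\<close>;
  \<open>differential P i\<close> is the matrix (row index first) of the map from the module with index \<open>Suc i\<close>
  to the one with index \<open>i\<close>; and \<open>augmentation P k\<close> is the image of \<open>e\<^sub>k\<close> under \<open>P\<^sub>0 \<rightarrow> K\<close>. Entries
  outside the index ranges given by \<open>rank\<close> are irrelevant.
\<close>

record (overloaded) ('n, 'k) free_complex =
  rank :: "nat \<Rightarrow> nat"
  gen_degree :: "nat \<Rightarrow> nat \<Rightarrow> int"
  differential :: "nat \<Rightarrow> nat \<Rightarrow> nat \<Rightarrow> ('n, 'k::zero) mpoly"
  augmentation :: "nat \<Rightarrow> 'k"

text \<open>For a submodule \<open>M\<close> of \<open>S\<close>, the module \<open>P\<^sub>i \<otimes>\<^sub>S M\<close> is the direct sum of \<open>rank P i\<close> copies of \<open>M\<close>,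
  the \<open>k\<close>-th one shifted by \<open>gen_degree P i k\<close>. Its elements are coordinate functions extended by
  zero. The case \<open>M = UNIV\<close> is \<open>P\<^sub>i\<close> itself.\<close>

definition chains ::
    "('n, 'k::comm_ring_1) free_complex \<Rightarrow> ('n, 'k) mpoly set \<Rightarrow> nat \<Rightarrow> (nat \<Rightarrow> ('n, 'k) mpoly) set"
  where "chains P M i = {v. (\<forall>k<rank P i. v k \<in> M) \<and> (\<forall>k\<ge>rank P i. v k = 0)}"

definition graded_chains ::
    "('n::finite, 'k::comm_ring_1) free_complex \<Rightarrow> ('n, 'k) mpoly set \<Rightarrow> nat \<Rightarrow> int
      \<Rightarrow> (nat \<Rightarrow> ('n, 'k) mpoly) set"
  where "graded_chains P M i j =
    {v \<in> chains P M i. \<forall>k<rank P i. v k \<in> homogeneous_part (j - gen_degree P i k)}"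

definition boundary ::
    "('n, 'k::comm_ring_1) free_complex \<Rightarrow> nat \<Rightarrow> (nat \<Rightarrow> ('n, 'k) mpoly) \<Rightarrow> nat \<Rightarrow> ('n, 'k) mpoly"
  where "boundary P i v =
    (\<lambda>l. if l < rank P i then \<Sum>k<rank P (Suc i). differential P i l k * v k else 0)"

text \<open>\<open>S\<close> acts on \<open>K = S/(x\<^sub>1, \<dots>, x\<^sub>n)\<close> through the constant coefficient \<open>lookup f 0\<close>.\<close>

definition augment ::
    "('n, 'k::comm_ring_1) free_complex \<Rightarrow> (nat \<Rightarrow> ('n, 'k) mpoly) \<Rightarrow> 'k"
  where "augment P v = (\<Sum>k<rank P 0. Poly_Mapping.lookup (v k) 0 * augmentation P k)"

text \<open>The first two conditions say that the maps are homogeneous of degree \<open>0\<close>, where \<open>K\<close> is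
  concentrated in degree \<open>0\<close>; the others say that the augmented complex is exact.\<close>

definition graded_free_resolution :: "('n::finite, 'k::field) free_complex \<Rightarrow> bool"
  where "graded_free_resolution P \<longleftrightarrow>
    (\<forall>i. \<forall>l<rank P i. \<forall>k<rank P (Suc i).
       differential P i l k \<in> homogeneous_part (gen_degree P (Suc i) k - gen_degree P i l)) \<and>
    (\<forall>k<rank P 0. augmentation P k \<noteq> 0 \<longrightarrow> gen_degree P 0 k = 0) \<and>
    augment P ` chains P UNIV 0 = UNIV \<and>
    {v \<in> chains P UNIV 0. augment P v = 0} = boundary P 0 ` chains P UNIV 1 \<and>
    (\<forall>i. {v \<in> chains P UNIV (Suc i). boundary P i v = 0}
          = boundary P (Suc i) ` chains P UNIV (Suc (Suc i)))"


section \<open>Tor, graded Betti numbers and regularity\<close>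

text \<open>\<open>Tor\<^sub>i(K, M)\<^sub>j\<close> is the quotient of \<open>tor_cycles P M i j\<close> by \<open>tor_boundaries P M i j\<close>, the degree
  \<open>j\<close> part of the homology of \<open>P \<otimes>\<^sub>S M\<close>, for a graded free resolution \<open>P\<close> of \<open>K\<close>.\<close>

definition tor_cycles ::
    "('n::finite, 'k::field) free_complex \<Rightarrow> ('n, 'k) mpoly set \<Rightarrow> nat \<Rightarrow> int
      \<Rightarrow> (nat \<Rightarrow> ('n, 'k) mpoly) set"
  where "tor_cycles P M i j =
    {v \<in> graded_chains P M i j. case i of 0 \<Rightarrow> True | Suc i' \<Rightarrow> boundary P i' v = 0}"

definition tor_boundaries ::
    "('n::finite, 'k::field) free_complex \<Rightarrow> ('n, 'k) mpoly set \<Rightarrow> nat \<Rightarrow> int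
      \<Rightarrow> (nat \<Rightarrow> ('n, 'k) mpoly) set"
  where "tor_boundaries P M i j = boundary P i ` graded_chains P M (Suc i) j"

definition chain_scale ::
    "'k::field \<Rightarrow> (nat \<Rightarrow> ('n, 'k) mpoly) \<Rightarrow> nat \<Rightarrow> ('n, 'k) mpoly"
  where "chain_scale c v = (\<lambda>k. Poly_Mapping.single 0 c * v k)"

interpretation chain_space: vector_space
    "chain_scale :: 'k::field \<Rightarrow> (nat \<Rightarrow> ('n, 'k) mpoly) \<Rightarrow> nat \<Rightarrow> ('n, 'k) mpoly"
  by standard
    (simp_all add: chain_scale_def fun_eq_iff distrib_left distrib_right single_add mult_single
      mult.assoc[symmetric])

text \<open>The choice of \<open>P\<close> is immaterial, since any two graded free resolutions of \<open>K\<close> are homotopy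
  equivalent; one exists, for instance the Koszul complex on the variables. The graded pieces are
  finite-dimensional, so that the difference below is the dimension of the quotient.\<close>

definition graded_betti :: "('n::finite, 'k::field) mpoly set \<Rightarrow> nat \<Rightarrow> int \<Rightarrow> nat"
  where "graded_betti M i j =
    (let P = SOME P. graded_free_resolution P
     in chain_space.dim (tor_cycles P M i j) - chain_space.dim (tor_boundaries P M i j))"

definition regularity :: "('n::finite, 'k::field) mpoly set \<Rightarrow> int"
  where "regularity M = Max {j - int i | i j. graded_betti M i j \<noteq> 0}"

end

theory Submission
  imports Defs "HOL-Library.FuncSet"
begin

text \<open>
  Since \<open>Tor\<close> does not depend on the resolution of \<open>K\<close>, it can be computed by the Koszul complex,
  which for a monomial ideal splits by multidegree: in degree \<open>a\<close> the homology is that of the simplicial complex of all sets \<open>B\<close> of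
  variables with \<open>x\<^sup>a / (\<Prod>t\<in>B. x\<^sub>t) \<in> I\<close>. Passing to \<open>I\<^sup>[\<^sup>q\<^sup>]\<close>, this complex becomes a cone
  with apex \<open>t\<close> if \<open>q\<close> does not divide \<open>a\<^sub>t\<close>, and in degree \<open>q a\<close> it is the complex of \<open>I\<close> in degree
  \<open>a\<close>. Hence the nonzero Betti numbers of \<open>I\<^sup>[\<^sup>q\<^sup>]\<close> sit at \<open>(i, q j)\<close> where \<open>(i, j)\<close> is one of those of
  \<open>I\<close>, and \<open>q j - i = q (j - i) + (q - 1) i\<close> with \<open>i \<le> n - 1\<close>.
\<close>

text \<open>\<open>graded_betti\<close> is computed from a resolution picked by \<open>SOME\<close>,
  so nothing is known about that resolution except its defining properties. Only the vanishing or
  non-vanishing of Betti numbers enters the regularity, so comparing two resolutions has to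
  transport the vanishing of homology only; no isomorphism of Tor is constructed.
  \<open>regularity\<close> is a \<open>Max\<close>, which carries information only for a finite
  nonempty set. Nonemptiness comes from a monomial of least degree in the ideal, and finiteness from
  cones once more: a multidegree beyond the exponents of finitely many generators (Dickson's lemma)
  has a cone as its complex. The same monomial of least degree gives
  \<open>regularity I \<ge> 1\<close>, which makes the quotient in \<alpha> meaningful. The bound i
  \<le> n - 1 holds because every cycle in homological degree n or more is zero. A cone whose apex
  is a variable dividing the multidegree also proves the Koszul complex exact, so one criterion
  serves the resolution, the divisibility by q and the finiteness.\<close>

section \<open>Homogeneous polynomials\<close>

text \<open>As a rewrite rule this fact of the interpretation loops together with \<open>mult.assoc\<close>.\<close>

declare ring_module.scale_scale [simp del]

abbreviation coeff :: "('n, 'k::zero) mpoly \<Rightarrow> ('n \<Rightarrow>\<^sub>0 nat) \<Rightarrow> 'k"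
  where "coeff \<equiv> Poly_Mapping.lookup"

lemma total_degree_zero [simp]: "total_degree 0 = 0"
  by (simp add: total_degree_def)

lemma total_degree_add: "total_degree (a + b) = total_degree a + total_degree b"
  by (simp add: total_degree_def lookup_add sum.distrib)

lemma lookup_le_total_degree: "Poly_Mapping.lookup a t \<le> total_degree a"
  unfolding total_degree_def by (rule member_le_sum) auto

lemma finite_lookup_bounded:
  "finite {a :: 'n::finite \<Rightarrow>\<^sub>0 nat. \<forall>t. Poly_Mapping.lookup a t \<le> d t}"
proof -
  have "finite (Pi\<^sub>E UNIV (\<lambda>t. {..d t}))"
    by (intro finite_PiE) auto
  moreover have "Poly_Mapping.lookup ` {a. \<forall>t. Poly_Mapping.lookup a t \<le> d t} \<subseteq> Pi\<^sub>E UNIV (\<lambda>t. {..d t})"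
    by auto
  ultimately have "finite (Poly_Mapping.lookup ` {a. \<forall>t. Poly_Mapping.lookup a t \<le> d t})"
    by (rule rev_finite_subset)
  then show ?thesis
    by (rule finite_imageD) (auto intro: inj_onI poly_mapping_eqI)
qed

lemma finite_total_degree: "finite {a :: 'n::finite \<Rightarrow>\<^sub>0 nat. total_degree a = d}"
  by (rule finite_subset[OF _ finite_lookup_bounded[of "\<lambda>_. d"]]) (auto simp: lookup_le_total_degree)

lemma homogeneous_part_zero [simp]: "0 \<in> homogeneous_part d"
  by (simp add: homogeneous_part_def)

lemma homogeneous_part_add:
  "f \<in> homogeneous_part d \<Longrightarrow> g \<in> homogeneous_part d \<Longrightarrow> f + g \<in> homogeneous_part d"
  unfolding homogeneous_part_def using keys_add[of f g] by blast

lemma homogeneous_part_sum: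
  "(\<And>x. x \<in> A \<Longrightarrow> f x \<in> homogeneous_part d) \<Longrightarrow> sum f A \<in> homogeneous_part d"
  by (induct A rule: infinite_finite_induct) (auto simp: homogeneous_part_add)

lemma homogeneous_part_mult:
  assumes "f \<in> homogeneous_part d" "g \<in> homogeneous_part e"
  shows "f * g \<in> homogeneous_part (d + e)"
  unfolding homogeneous_part_def
proof (intro CollectI ballI)
  fix a assume "a \<in> Poly_Mapping.keys (f * g)"
  then obtain b c where "a = b + c" "b \<in> Poly_Mapping.keys f" "c \<in> Poly_Mapping.keys g"
    using keys_mult[of f g] by blast
  then show "int (total_degree a) = d + e"
    using assms by (auto simp: homogeneous_part_def total_degree_add)
qed

lemma homogeneous_part_uminus: "f \<in> homogeneous_part d \<Longrightarrow> - f \<in> homogeneous_part d"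
  by (simp add: homogeneous_part_def in_keys_iff)

lemma homogeneous_part_diff:
  "f \<in> homogeneous_part d \<Longrightarrow> g \<in> homogeneous_part d \<Longrightarrow> f - g \<in> homogeneous_part d"
  using homogeneous_part_add[of f d "- g"] homogeneous_part_uminus[of g d] by simp

lemma homogeneous_part_one: "1 \<in> homogeneous_part 0"
  by (simp add: homogeneous_part_def)

text \<open>Exactness of a resolution is stated without grading; this projection is what makes
  preimages homogeneous.\<close>

definition hom_component :: "int \<Rightarrow> ('n::finite, 'k::comm_ring_1) mpoly \<Rightarrow> ('n, 'k) mpoly"
  where "hom_component d f = Poly_Mapping.mapp (\<lambda>a c. if int (total_degree a) = d then c else 0) f"

lemma coeff_hom_component:
  "coeff (hom_component d f) a = (if int (total_degree a) = d then coeff f a else 0)"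
  by (simp add: hom_component_def lookup_mapp when_def in_keys_iff)

lemma hom_component_homogeneous: "hom_component d f \<in> homogeneous_part d"
  by (auto simp: homogeneous_part_def in_keys_iff coeff_hom_component split: if_splits)

lemma hom_component_of_homogeneous: "f \<in> homogeneous_part d \<Longrightarrow> hom_component d f = f"
  by (intro poly_mapping_eqI) (auto simp: homogeneous_part_def in_keys_iff coeff_hom_component)

lemma hom_component_add: "hom_component d (f + g) = hom_component d f + hom_component d g"
  by (intro poly_mapping_eqI) (simp add: lookup_add coeff_hom_component)

lemma hom_component_zero [simp]: "hom_component d 0 = 0"
  by (intro poly_mapping_eqI) (simp add: coeff_hom_component)

lemma hom_component_sum: "hom_component d (sum f A) = (\<Sum>x\<in>A. hom_component d (f x))"
  by (induct A rule: infinite_finite_induct) (auto simp: hom_component_add)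

text \<open>A term of degree \<open>d\<close> in a product with \<open>f\<close>, which is
  homogeneous of degree \<open>e\<close>, needs a term of degree \<open>d - e\<close> in the other
  factor; the remainder \<open>r\<close> of \<open>g\<close> has none.\<close>

lemma hom_component_mult:
  assumes "f \<in> homogeneous_part e"
  shows "hom_component d (f * g) = f * hom_component (d - e) g"
proof -
  define r where "r = g - hom_component (d - e) g"
  have "coeff (f * r) a = 0" if a: "int (total_degree a) = d" for a
  proof (rule ccontr)
    assume "coeff (f * r) a \<noteq> 0"
    then have "a \<in> Poly_Mapping.keys (f * r)" by (simp add: in_keys_iff)
    then obtain b c where "a = b + c" "b \<in> Poly_Mapping.keys f" "c \<in> Poly_Mapping.keys r"
      using keys_mult[of f r] by blast
    moreover from this have "int (total_degree b) = e"
      using assms by (auto simp: homogeneous_part_def)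
    ultimately have "int (total_degree c) = d - e" "coeff r c \<noteq> 0"
      using a by (auto simp: total_degree_add in_keys_iff)
    then show False
      by (simp add: r_def lookup_minus coeff_hom_component)
  qed
  then have "hom_component d (f * r) = 0"
    by (intro poly_mapping_eqI) (auto simp: coeff_hom_component)
  moreover have "f * g = f * hom_component (d - e) g + f * r"
    by (simp add: r_def algebra_simps)
  moreover have "hom_component d (f * hom_component (d - e) g) = f * hom_component (d - e) g"
    using homogeneous_part_mult[OF assms hom_component_homogeneous[of "d - e" g]]
    by (intro hom_component_of_homogeneous) simp
  ultimately show ?thesis
    by (simp add: hom_component_add)
qed

lemma coeff_mult_single_plus:
  "coeff (Poly_Mapping.single a c * f) (a + m) = c * coeff f m"
proof -
  have "coeff (Poly_Mapping.single a c * f) (a + m)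
      = (\<Sum>l. (c * (\<Sum>q. coeff f q when a + m = l + q)) when l = a)"
    unfolding lookup_mult lookup_single by (intro Sum_any.cong) (auto simp: when_def)
  also have "\<dots> = c * (\<Sum>q. coeff f q when m = q)"
    by simp
  finally show ?thesis by simp
qed

lemma coeff_mult_single_eq_0:
  assumes "\<And>b. m \<noteq> a + b"
  shows "coeff (Poly_Mapping.single a c * f) m = 0"
proof (rule ccontr)
  assume "coeff (Poly_Mapping.single a c * f) m \<noteq> 0"
  then have "m \<in> Poly_Mapping.keys (Poly_Mapping.single a c * f)" by (simp add: in_keys_iff)
  then show False
    using keys_mult[of "Poly_Mapping.single a c" f] assms by (auto split: if_splits)
qed

lemma add_eq_0_poly_mapping_nat:
  "(a + b = 0) \<longleftrightarrow> (a = 0 \<and> b = (0 :: 'n \<Rightarrow>\<^sub>0 nat))"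
  by (auto simp: poly_mapping_eq_iff fun_eq_iff lookup_add)

text \<open>Exponents are natural numbers, so a product of monomials is constant only if both
  factors are. Reading off the constant coefficient is thus a ring map, which makes
  \<open>augment\<close> linear over \<open>S\<close>.\<close>

lemma coeff_mult_0: "coeff (f * g) 0 = coeff f 0 * coeff (g :: ('n, 'k::comm_ring_1) mpoly) 0"
proof -
  define r where "r = f - Poly_Mapping.single 0 (coeff f 0)"
  have "coeff (r * g) 0 = 0"
  proof (rule ccontr)
    assume "coeff (r * g) 0 \<noteq> 0"
    then have "0 \<in> Poly_Mapping.keys (r * g)" by (simp add: in_keys_iff)
    then have "0 \<in> Poly_Mapping.keys r"
      using keys_mult[of r g] add_eq_0_poly_mapping_nat by (smt (verit) mem_Collect_eq subsetD)
    then show False by (simp add: in_keys_iff r_def lookup_minus)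
  qed
  moreover have "f * g = Poly_Mapping.single 0 (coeff f 0) * g + r * g"
    by (simp add: r_def algebra_simps)
  ultimately show ?thesis
    using coeff_mult_single_plus[of 0 "coeff f 0" g 0] by (simp add: lookup_add)
qed

section \<open>Independence of Tor from the resolution\<close>

definition unit_vec :: "nat \<Rightarrow> nat \<Rightarrow> 'a::zero_neq_one"
  where "unit_vec k = (\<lambda>l. if l = k then 1 else 0)"

lemma sum_unit_vec [simp]:
  fixes g :: "nat \<Rightarrow> 'a::comm_ring_1"
  shows "(\<Sum>l<r. unit_vec k l * g l) = (if k < r then g k else 0)"
    and "(\<Sum>l<r. g l * unit_vec k l) = (if k < r then g k else 0)"
    and "(\<Sum>l<r. g l * unit_vec l k) = (if k < r then g k else 0)"
proof -
  have "(\<Sum>l<r. unit_vec k l * g l) = (\<Sum>l<r. if l = k then g l else 0)"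
    by (intro sum.cong) (auto simp: unit_vec_def)
  then show *: "(\<Sum>l<r. unit_vec k l * g l) = (if k < r then g k else 0)" by simp
  then show "(\<Sum>l<r. g l * unit_vec k l) = (if k < r then g k else 0)" by (simp add: mult.commute)
  have "(\<Sum>l<r. g l * unit_vec l k) = (\<Sum>l<r. if l = k then g l else 0)"
    by (intro sum.cong) (auto simp: unit_vec_def)
  then show "(\<Sum>l<r. g l * unit_vec l k) = (if k < r then g k else 0)" by simp
qed

text \<open>Maps out of a free module are stored as the images \<open>f k\<close> of the basis
  vectors, so linearity over \<open>S\<close> is built in and identities between maps can be checked
  on \<open>unit_vec k\<close>.\<close>

definition lin_ext :: "nat \<Rightarrow> (nat \<Rightarrow> nat \<Rightarrow> 'a::comm_ring_1) \<Rightarrow> (nat \<Rightarrow> 'a) \<Rightarrow> nat \<Rightarrow> 'a"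
  where "lin_ext r f v = (\<lambda>l. \<Sum>k<r. v k * f k l)"

lemma lin_ext_zero [simp]: "lin_ext r f 0 = 0"
  by (simp add: lin_ext_def fun_eq_iff)

lemma lin_ext_diff_right: "lin_ext r f (v - w) = lin_ext r f v - lin_ext r f w"
  by (simp add: lin_ext_def fun_eq_iff left_diff_distrib sum_subtractf)

lemma lin_ext_diff_left: "lin_ext r (\<lambda>k. f k - g k) v = lin_ext r f v - lin_ext r g v"
  by (simp add: lin_ext_def fun_eq_iff right_diff_distrib sum_subtractf)

lemma lin_ext_cong: "(\<And>k. k < r \<Longrightarrow> f k = g k) \<Longrightarrow> lin_ext r f v = lin_ext r g v"
  by (simp add: lin_ext_def fun_eq_iff)

lemma lin_ext_comp: "lin_ext s g (lin_ext r f v) = lin_ext r (\<lambda>k. lin_ext s g (f k)) v"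
proof
  fix l
  have "lin_ext s g (lin_ext r f v) l = (\<Sum>k<s. \<Sum>m<r. v m * (f m k * g k l))"
    by (simp add: lin_ext_def sum_distrib_right mult.assoc)
  also have "\<dots> = (\<Sum>m<r. \<Sum>k<s. v m * (f m k * g k l))"
    by (rule sum.swap)
  finally show "lin_ext s g (lin_ext r f v) l = lin_ext r (\<lambda>k. lin_ext s g (f k)) v l"
    by (simp add: lin_ext_def sum_distrib_left)
qed

lemma lin_ext_unit_vec: "k < r \<Longrightarrow> lin_ext r f (unit_vec k) = f k"
  by (simp add: lin_ext_def)

lemma lin_ext_unit_vec_right:
  assumes "\<And>k. k \<ge> r \<Longrightarrow> v k = 0" shows "lin_ext r unit_vec v = v"
proof
  fix l show "lin_ext r unit_vec v l = v l"
    using assms[of l]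
    by (simp add: lin_ext_def)
qed

lemma unit_vec_chains: "k < rank P i \<Longrightarrow> unit_vec k \<in> chains P UNIV i"
  by (auto simp: chains_def unit_vec_def)

lemma boundary_lin_ext:
  "boundary P i v = lin_ext (rank P (Suc i)) (\<lambda>k. boundary P i (unit_vec k)) v"
  by (auto simp: boundary_def lin_ext_def fun_eq_iff mult.commute intro!: sum.cong)

lemma boundary_comp_lin_ext:
  "boundary P i (lin_ext r f v) = lin_ext r (\<lambda>k. boundary P i (f k)) v"
  by (simp add: boundary_lin_ext[of P i "lin_ext r f v"] lin_ext_comp)
    (simp flip: boundary_lin_ext)

lemma boundary_zero [simp]: "boundary P i 0 = 0"
  by (subst boundary_lin_ext) simp

lemma boundary_diff: "boundary P i (v - w) = boundary P i v - boundary P i w"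
  by (subst (1 2 3) boundary_lin_ext) (rule lin_ext_diff_right)

lemma augment_lin_ext:
  "augment P (lin_ext r f v) = (\<Sum>k<r. coeff (v k) 0 * augment P (f k))"
proof -
  have "augment P (lin_ext r f v) = (\<Sum>l<rank P 0. \<Sum>k<r. coeff (v k) 0 * (coeff (f k l) 0 * augmentation P l))"
    by (simp add: augment_def lin_ext_def lookup_sum coeff_mult_0 sum_distrib_right mult.assoc)
  also have "\<dots> = (\<Sum>k<r. \<Sum>l<rank P 0. coeff (v k) 0 * (coeff (f k l) 0 * augmentation P l))"
    by (rule sum.swap)
  finally show ?thesis by (simp add: augment_def sum_distrib_left)
qed

lemma augment_unit_vec:
  fixes P :: "('b::finite, 'c::comm_ring_1) free_complex"
  shows "k < rank P 0 \<Longrightarrow> augment P (unit_vec k) = augmentation P k"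
proof -
  assume "k < rank P 0"
  moreover have "coeff (unit_vec k l :: ('b, 'c) mpoly) 0 = unit_vec k l" for l
    by (simp add: unit_vec_def)
  ultimately show ?thesis by (simp add: augment_def)
qed

lemma augment_diff: "augment P (v - w) = augment P v - augment P w"
  by (simp add: augment_def lookup_minus left_diff_distrib sum_subtractf)

lemma graded_chains_subset: "graded_chains P M i j \<subseteq> chains P M i"
  by (auto simp: graded_chains_def)

lemma chains_diff:
  assumes "ring_module.subspace M" "v \<in> chains P M i" "w \<in> chains P M i"
  shows "v - w \<in> chains P M i"
  using assms by (auto simp: chains_def intro: ring_module.subspace_diff)

lemma graded_chains_diff:
  assumes "ring_module.subspace M" "v \<in> graded_chains P M i j" "w \<in> graded_chains P M i j"
  shows "v - w \<in> graded_chains P M i j"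
  using assms chains_diff[of M v P i w]
  by (auto simp: graded_chains_def homogeneous_part_diff)

text \<open>The map has entries in \<open>S\<close> while \<open>v\<close> has coordinates in the
  ideal \<open>M\<close>, so the induced map on the tensor product with \<open>M\<close> is given by
  the same formula. Chain maps and homotopies found over \<open>S\<close> therefore apply to Tor at
  once.\<close>

lemma lin_ext_chains:
  assumes M: "ring_module.subspace M" and v: "v \<in> chains P M i"
    and f: "\<And>k. k < rank P i \<Longrightarrow> f k \<in> chains Q UNIV i'"
  shows "lin_ext (rank P i) f v \<in> chains Q M i'"
proof -
  have "(\<Sum>k<rank P i. v k * f k l) \<in> M" for l
  proof (rule ring_module.subspace_sum[OF M])
    fix k assume "k \<in> {..<rank P i}"
    then show "v k * f k l \<in> M"
      using v ring_module.subspace_scale[OF M, of "v k" "f k l"] by (simp add: chains_def mult.commute)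
  qed
  moreover have "(\<Sum>k<rank P i. v k * f k l) = 0" if "l \<ge> rank Q i'" for l
    using f that by (intro sum.neutral) (auto simp: chains_def)
  ultimately show ?thesis by (auto simp: chains_def lin_ext_def)
qed

lemma lin_ext_graded_chains:
  assumes M: "ring_module.subspace M" and v: "v \<in> graded_chains P M i j"
    and f: "\<And>k. k < rank P i \<Longrightarrow> f k \<in> graded_chains Q UNIV i' (gen_degree P i k)"
  shows "lin_ext (rank P i) f v \<in> graded_chains Q M i' j"
proof -
  have "lin_ext (rank P i) f v \<in> chains Q M i'"
    using v f graded_chains_subset by (intro lin_ext_chains[OF M]) blast+
  moreover have "lin_ext (rank P i) f v l \<in> homogeneous_part (j - gen_degree Q i' l)" if l: "l < rank Q i'" for l
    unfolding lin_ext_def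
  proof (rule homogeneous_part_sum)
    fix k assume "k \<in> {..<rank P i}"
    then have "v k \<in> homogeneous_part (j - gen_degree P i k)"
      "f k l \<in> homogeneous_part (gen_degree P i k - gen_degree Q i' l)"
      using v f l by (auto simp: graded_chains_def)
    from homogeneous_part_mult[OF this]
    show "v k * f k l \<in> homogeneous_part (j - gen_degree Q i' l)" by simp
  qed
  ultimately show ?thesis by (simp add: graded_chains_def)
qed

lemma unit_vec_graded_chains:
  "k < rank P i \<Longrightarrow> unit_vec k \<in> graded_chains P UNIV i (gen_degree P i k)"
  using unit_vec_chains[of k P i]
  by (auto simp: graded_chains_def unit_vec_def homogeneous_part_one)

lemma boundary_unit_vec_graded:
  assumes "graded_free_resolution P" "k < rank P (Suc i)"
  shows "boundary P i (unit_vec k) \<in> graded_chains P UNIV i (gen_degree P (Suc i) k)"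
proof -
  have "boundary P i (unit_vec k) l = (if l < rank P i then differential P i l k else 0)" for l
    using assms(2) by (simp add: boundary_def)
  then show ?thesis
    using assms by (auto simp: graded_chains_def chains_def graded_free_resolution_def)
qed

lemma boundary_graded_chains:
  assumes "graded_free_resolution P" "ring_module.subspace M" "v \<in> graded_chains P M (Suc i) j"
  shows "boundary P i v \<in> graded_chains P M i j"
  using assms by (subst boundary_lin_ext) (intro lin_ext_graded_chains boundary_unit_vec_graded)

lemma boundary_chains:
  assumes "ring_module.subspace M" "v \<in> chains P M (Suc i)"
  shows "boundary P i v \<in> chains P M i"
  using assms by (subst boundary_lin_ext) (intro lin_ext_chains, auto simp: chains_def boundary_def)

section \<open>Lifting along resolutions and uniqueness up to homotopy\<close>

text \<open>Treating the augmentation as the map out of index 0 lets exactness at index 0 and at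
  higher indices be stated as one condition.\<close>

definition aug_cycle :: "('n::finite, 'k::comm_ring_1) free_complex \<Rightarrow> nat \<Rightarrow> (nat \<Rightarrow> ('n, 'k) mpoly) \<Rightarrow> bool"
  where "aug_cycle P i v \<longleftrightarrow> (case i of 0 \<Rightarrow> augment P v = 0 | Suc i' \<Rightarrow> boundary P i' v = 0)"

lemma aug_cycle_simps [simp]:
  "aug_cycle P 0 v \<longleftrightarrow> augment P v = 0" "aug_cycle P (Suc i) v \<longleftrightarrow> boundary P i v = 0"
  by (simp_all add: aug_cycle_def)

lemma aug_cycle_iff_boundary:
  assumes "graded_free_resolution P"
  shows "v \<in> chains P UNIV i \<and> aug_cycle P i v \<longleftrightarrow> v \<in> boundary P i ` chains P UNIV (Suc i)"
proof (cases i)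
  case 0
  then show ?thesis using assms unfolding graded_free_resolution_def by auto
next
  case (Suc i')
  then have "{v \<in> chains P UNIV i. boundary P i' v = 0} = boundary P i ` chains P UNIV (Suc i)"
    using assms unfolding graded_free_resolution_def by blast
  then show ?thesis using Suc by (auto simp: set_eq_iff)
qed

lemma aug_cycle_boundary:
  assumes "graded_free_resolution P" "v \<in> chains P UNIV (Suc i)"
  shows "aug_cycle P i (boundary P i v)"
  using aug_cycle_iff_boundary[OF assms(1), of "boundary P i v" i] assms(2) by blast

text \<open>Exactness supplies some preimage \<open>u\<close>. Its components in the degrees
  prescribed by the generators still map to \<open>v\<close>, because the entries of the
  differential are homogeneous.\<close>

lemma graded_preimage:
  assumes P: "graded_free_resolution P" and v: "v \<in> graded_chains P UNIV i j" "aug_cycle P i v"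
  shows "\<exists>u \<in> graded_chains P UNIV (Suc i) j. boundary P i u = v"
proof -
  obtain u where u: "u \<in> chains P UNIV (Suc i)" "boundary P i u = v"
    using aug_cycle_iff_boundary[OF P, of v i] v graded_chains_subset by blast
  define u' where "u' = (\<lambda>k. hom_component (j - gen_degree P (Suc i) k) (u k))"
  have "u' \<in> graded_chains P UNIV (Suc i) j"
    using u(1) by (auto simp: graded_chains_def chains_def u'_def hom_component_homogeneous)
  moreover have "boundary P i u' l = v l" for l
  proof (cases "l < rank P i")
    case True
    have D: "differential P i l k \<in> homogeneous_part (gen_degree P (Suc i) k - gen_degree P i l)"
      if "k < rank P (Suc i)" for k
      using P True that by (auto simp: graded_free_resolution_def)
    have "v l = hom_component (j - gen_degree P i l) (v l)"
      using v True by (intro hom_component_of_homogeneous[symmetric]) (auto simp: graded_chains_def)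
    also have "\<dots> = hom_component (j - gen_degree P i l) (\<Sum>k<rank P (Suc i). differential P i l k * u k)"
      using u(2) True by (auto simp: boundary_def)
    also have "\<dots> = (\<Sum>k<rank P (Suc i). differential P i l k * u' k)"
      unfolding hom_component_sum by (intro sum.cong refl) (simp add: u'_def hom_component_mult[OF D])
    finally show ?thesis using True by (simp add: boundary_def)
  next
    case False
    then show ?thesis using u(2) by (auto simp: boundary_def)
  qed
  ultimately show ?thesis by blast
qed

text \<open>The identity of \<open>K\<close> is lifted index by index: a basis vector at index
  \<open>Suc i\<close> goes to a homogeneous preimage of a cycle that the map at index
  \<open>i\<close> has already determined.\<close>

lemma comparison_map:
  assumes P: "graded_free_resolution (P :: ('n::finite, 'k::field) free_complex)" and Q: "graded_free_resolution Q"
  shows "\<exists>f. (\<forall>i. \<forall>k<rank P i. f i k \<in> graded_chains Q UNIV i (gen_degree P i k)) \<and>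
    (\<forall>v. augment Q (lin_ext (rank P 0) (f 0) v) = augment P v) \<and>
    (\<forall>i v. boundary Q i (lin_ext (rank P (Suc i)) (f (Suc i)) v) = lin_ext (rank P i) (f i) (boundary P i v))"
proof -
  \<comment> \<open>Sending cycles to cycles is part of the invariant because it is what makes the
    next lift possible. At index 0 it follows from compatibility with the augmentations.\<close>
  let ?good = "\<lambda>i f. (\<forall>k<rank P i. f k \<in> graded_chains Q UNIV i (gen_degree P i k)) \<and>
    (\<forall>v \<in> chains P UNIV i. aug_cycle P i v \<longrightarrow> aug_cycle Q i (lin_ext (rank P i) f v)) \<and>
    (i = 0 \<longrightarrow> (\<forall>v. augment Q (lin_ext (rank P 0) f v) = augment P v))"
  let ?next = "\<lambda>i f g. \<forall>v. boundary Q i (lin_ext (rank P (Suc i)) g v) = lin_ext (rank P i) f (boundary P i v)"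
  have "\<exists>f. \<forall>i. ?good i (f i) \<and> ?next i (f i) (f (Suc i))"
  proof (rule dependent_nat_choice)
    obtain e where e: "e \<in> chains Q UNIV 0" "augment Q e = 1"
    proof -
      have "1 \<in> augment Q ` chains Q UNIV 0"
        using Q unfolding graded_free_resolution_def by auto
      then show ?thesis using that by (metis imageE)
    qed
    \<comment> \<open>Cutting \<open>e\<close> down to degree 0 does not change its augmentation,
      because only generators of degree 0 have a nonzero augmentation.\<close>
    define e' where "e' = (\<lambda>l. hom_component (- gen_degree Q 0 l) (e l))"
    have e': "e' \<in> graded_chains Q UNIV 0 0"
      using e(1) by (auto simp: graded_chains_def chains_def e'_def hom_component_homogeneous)
    have aug: "augmentation Q l \<noteq> 0 \<Longrightarrow> gen_degree Q 0 l = 0" if "l < rank Q 0" for l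
      using Q that unfolding graded_free_resolution_def by auto
    have "augment Q e' = augment Q e"
      unfolding augment_def using aug
      by (intro sum.cong refl) (auto simp: e'_def coeff_hom_component)
    then have e'1: "augment Q e' = 1" using e by simp
    \<comment> \<open>Each basis vector goes to a scalar multiple of \<open>e'\<close>. The degree
      is right because the scalar is zero unless \<open>gen_degree P 0 k\<close> is 0.\<close>
    define f where "f k = (\<lambda>l. Poly_Mapping.single 0 (augmentation P k) * e' l)" for k
    have augP: "augmentation P k \<noteq> 0 \<Longrightarrow> gen_degree P 0 k = 0" if "k < rank P 0" for k
      using P that unfolding graded_free_resolution_def by auto
    have hom: "Poly_Mapping.single 0 (augmentation P k) \<in> homogeneous_part 0" for k
      by (simp add: homogeneous_part_def)
    have "f k \<in> graded_chains Q UNIV 0 (gen_degree P 0 k)" if k: "k < rank P 0" for k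
    proof (cases "augmentation P k = 0")
      case True
      then show ?thesis by (simp add: f_def graded_chains_def chains_def)
    next
      case False
      then show ?thesis
        using e' augP[OF k] homogeneous_part_mult[OF hom[of k], of "e' _"]
        by (force simp: f_def graded_chains_def chains_def)
    qed
    moreover have "augment Q (f k) = augmentation P k" for k
    proof -
      have "augment Q (f k) = augmentation P k * augment Q e'"
        by (simp add: augment_def f_def coeff_mult_0 sum_distrib_left mult.assoc)
      then show ?thesis by (simp add: e'1)
    qed
    then have "augment Q (lin_ext (rank P 0) f v) = augment P v" for v
      by (simp add: augment_lin_ext) (simp add: augment_def)
    ultimately have "?good 0 f" by simp
    then show "\<exists>f. ?good 0 f" by (rule exI[of _ f])
  next
    fix f i assume f: "?good i f"
    have "\<exists>u. u \<in> graded_chains Q UNIV (Suc i) (gen_degree P (Suc i) k) \<and>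
        boundary Q i u = lin_ext (rank P i) f (boundary P i (unit_vec k))" if k: "k < rank P (Suc i)" for k
    proof -
      have "lin_ext (rank P i) f (boundary P i (unit_vec k)) \<in> graded_chains Q UNIV i (gen_degree P (Suc i) k)"
        using f boundary_unit_vec_graded[OF P k] by (intro lin_ext_graded_chains) auto
      moreover have "aug_cycle Q i (lin_ext (rank P i) f (boundary P i (unit_vec k)))"
        using f boundary_unit_vec_graded[OF P k] graded_chains_subset
          aug_cycle_boundary[OF P unit_vec_chains[OF k]] by blast
      ultimately show ?thesis using graded_preimage[OF Q] by blast
    qed
    then obtain g where g: "\<And>k. k < rank P (Suc i) \<Longrightarrow> g k \<in> graded_chains Q UNIV (Suc i) (gen_degree P (Suc i) k)"
      "\<And>k. k < rank P (Suc i) \<Longrightarrow> boundary Q i (g k) = lin_ext (rank P i) f (boundary P i (unit_vec k))"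
      by metis
    have nxt: "?next i f g"
    proof
      fix v
      have "boundary Q i (lin_ext (rank P (Suc i)) g v)
          = lin_ext (rank P (Suc i)) (\<lambda>k. lin_ext (rank P i) f (boundary P i (unit_vec k))) v"
        unfolding boundary_comp_lin_ext by (rule lin_ext_cong) (rule g(2))
      also have "\<dots> = lin_ext (rank P i) f (boundary P i v)"
        by (simp add: boundary_lin_ext[of P i v] lin_ext_comp)
      finally show "boundary Q i (lin_ext (rank P (Suc i)) g v) = lin_ext (rank P i) f (boundary P i v)" .
    qed
    moreover have "?good (Suc i) g" using g(1) nxt by simp
    ultimately show "\<exists>g. ?good (Suc i) g \<and> ?next i f g" by blast
  qed
  then obtain f where "\<forall>i. ?good i (f i) \<and> ?next i (f i) (f (Suc i))" by (rule exE)
  then show ?thesis by (intro exI[of _ f]) simp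
qed

text \<open>The usual identity \<open>\<partial> h + h \<partial> = \<phi>\<close> is kept only on
  cycles, where the term \<open>h \<partial>\<close> drops out; a class in Tor is represented by a
  cycle, so this suffices. At index 0 every chain qualifies, matching the absence of a cycle
  condition in \<open>tor_cycles\<close>.\<close>

lemma null_homotopy:
  assumes P: "graded_free_resolution (P :: ('n::finite, 'k::field) free_complex)"
    and \<phi>: "\<And>i k. k < rank P i \<Longrightarrow> \<phi> i k \<in> graded_chains P UNIV i (gen_degree P i k)"
    and aug: "\<And>v. augment P (lin_ext (rank P 0) (\<phi> 0) v) = 0"
    and chain: "\<And>i v. v \<in> chains P UNIV (Suc i) \<Longrightarrow>
      boundary P i (lin_ext (rank P (Suc i)) (\<phi> (Suc i)) v) = lin_ext (rank P i) (\<phi> i) (boundary P i v)"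
  shows "\<exists>h. (\<forall>i. \<forall>k<rank P i. h i k \<in> graded_chains P UNIV (Suc i) (gen_degree P i k)) \<and>
    (\<forall>i. \<forall>v \<in> chains P UNIV i. (i = 0 \<or> aug_cycle P i v) \<longrightarrow>
      boundary P i (lin_ext (rank P i) (h i) v) = lin_ext (rank P i) (\<phi> i) v)"
proof -
  let ?good = "\<lambda>i h. (\<forall>k<rank P i. h k \<in> graded_chains P UNIV (Suc i) (gen_degree P i k)) \<and>
    (\<forall>v \<in> chains P UNIV i. (i = 0 \<or> aug_cycle P i v) \<longrightarrow>
      boundary P i (lin_ext (rank P i) h v) = lin_ext (rank P i) (\<phi> i) v)"
  \<comment> \<open>The relation between consecutive choices is \<open>True\<close>: restricted to
    cycles, the statement about \<open>h i\<close> does not mention the preceding map.\<close>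
  have "\<exists>h. \<forall>i. ?good i (h i) \<and> True"
  proof (rule dependent_nat_choice)
    have "aug_cycle P 0 (\<phi> 0 k)" if "k < rank P 0" for k
      using aug[of "unit_vec k"] lin_ext_unit_vec[OF that, of "\<phi> 0"] by simp
    then have "\<exists>u. u \<in> graded_chains P UNIV (Suc 0) (gen_degree P 0 k) \<and> boundary P 0 u = \<phi> 0 k"
      if "k < rank P 0" for k
      using graded_preimage[OF P \<phi>[OF that]] that by blast
    then obtain h where h: "\<And>k. k < rank P 0 \<Longrightarrow> h k \<in> graded_chains P UNIV (Suc 0) (gen_degree P 0 k)"
      "\<And>k. k < rank P 0 \<Longrightarrow> boundary P 0 (h k) = \<phi> 0 k"
      by metis
    have "boundary P 0 (lin_ext (rank P 0) h v) = lin_ext (rank P 0) (\<phi> 0) v" for v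
      unfolding boundary_comp_lin_ext using h(2) by (rule lin_ext_cong)
    then have "?good 0 h" using h(1) by simp
    then show "\<exists>h. ?good 0 h" by (rule exI[of _ h])
  next
    fix h i assume h: "?good i h"
    \<comment> \<open>Subtracting \<open>h\<close> applied to the boundary turns \<phi> into a map
      with values in cycles: the boundary of a basis vector is a cycle, and on cycles the induction
      hypothesis computes the boundary of \<open>h\<close>.\<close>
    define \<psi> where "\<psi> k = \<phi> (Suc i) k - lin_ext (rank P i) h (boundary P i (unit_vec k))" for k
    have "\<exists>u. u \<in> graded_chains P UNIV (Suc (Suc i)) (gen_degree P (Suc i) k) \<and> boundary P (Suc i) u = \<psi> k"
      if k: "k < rank P (Suc i)" for k
    proof -
      let ?w = "boundary P i (unit_vec k)"
      have w: "?w \<in> graded_chains P UNIV i (gen_degree P (Suc i) k)"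
        using boundary_unit_vec_graded[OF P k] .
      have cyc: "aug_cycle P i ?w" using aug_cycle_boundary[OF P unit_vec_chains[OF k]] .
      have "\<psi> k \<in> graded_chains P UNIV (Suc i) (gen_degree P (Suc i) k)"
        unfolding \<psi>_def using h w by (intro graded_chains_diff \<phi>[OF k] lin_ext_graded_chains) auto
      moreover have "boundary P i (\<psi> k) = 0"
      proof -
        have "boundary P i (lin_ext (rank P i) h ?w) = lin_ext (rank P i) (\<phi> i) ?w"
          using h w cyc graded_chains_subset by blast
        moreover have "boundary P i (\<phi> (Suc i) k) = lin_ext (rank P i) (\<phi> i) ?w"
          using chain[OF unit_vec_chains[OF k]] lin_ext_unit_vec[OF k, of "\<phi> (Suc i)"] by simp
        ultimately show ?thesis by (simp add: \<psi>_def boundary_diff)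
      qed
      then have "aug_cycle P (Suc i) (\<psi> k)" by simp
      ultimately show ?thesis using graded_preimage[OF P] by blast
    qed
    then obtain g where g: "\<And>k. k < rank P (Suc i) \<Longrightarrow> g k \<in> graded_chains P UNIV (Suc (Suc i)) (gen_degree P (Suc i) k)"
      "\<And>k. k < rank P (Suc i) \<Longrightarrow> boundary P (Suc i) (g k) = \<psi> k"
      by metis
    have "boundary P (Suc i) (lin_ext (rank P (Suc i)) g v) = lin_ext (rank P (Suc i)) (\<phi> (Suc i)) v"
      if "boundary P i v = 0" for v
    proof -
      have "boundary P (Suc i) (lin_ext (rank P (Suc i)) g v) = lin_ext (rank P (Suc i)) \<psi> v"
        unfolding boundary_comp_lin_ext using g(2) by (rule lin_ext_cong)
      also have "\<dots> = lin_ext (rank P (Suc i)) (\<phi> (Suc i)) v - lin_ext (rank P i) h (boundary P i v)"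
        unfolding \<psi>_def lin_ext_diff_left by (simp add: boundary_lin_ext[of P i v] lin_ext_comp)
      finally show ?thesis using that by simp
    qed
    then have "?good (Suc i) g" using g(1) by simp
    then show "\<exists>g. ?good (Suc i) g \<and> True" by blast
  qed
  then obtain h where "\<forall>i. ?good i (h i) \<and> True" by (rule exE)
  then show ?thesis by (intro exI[of _ h]) simp
qed

text \<open>A cycle \<open>v\<close> over \<open>P\<close> is sent to a boundary
  \<open>f v = \<partial> w\<close> over \<open>Q\<close>. With a homotopy \<open>h\<close> for
  \<open>g f - id\<close>, the chain \<open>g w - h v\<close> bounds \<open>v\<close>, since
  \<open>\<partial> (g w) = g (f v)\<close> and
  \<open>\<partial> (h v) = g (f v) - v\<close>.\<close>

theorem tor_vanishing_independent:
  assumes P: "graded_free_resolution (P :: ('n::finite, 'k::field) free_complex)" and Q: "graded_free_resolution Q"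
    and M: "ring_module.subspace M"
    and van: "tor_cycles Q M i j \<subseteq> tor_boundaries Q M i j"
  shows "tor_cycles P M i j \<subseteq> tor_boundaries P M i j"
proof
  obtain f where f: "\<And>i k. k < rank P i \<Longrightarrow> f i k \<in> graded_chains Q UNIV i (gen_degree P i k)"
    "\<And>v. augment Q (lin_ext (rank P 0) (f 0) v) = augment P v"
    "\<And>i v. boundary Q i (lin_ext (rank P (Suc i)) (f (Suc i)) v) = lin_ext (rank P i) (f i) (boundary P i v)"
    using comparison_map[OF P Q] by blast
  obtain g where g: "\<And>i k. k < rank Q i \<Longrightarrow> g i k \<in> graded_chains P UNIV i (gen_degree Q i k)"
    "\<And>v. augment P (lin_ext (rank Q 0) (g 0) v) = augment Q v"
    "\<And>i v. boundary P i (lin_ext (rank Q (Suc i)) (g (Suc i)) v) = lin_ext (rank Q i) (g i) (boundary Q i v)"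
    using comparison_map[OF Q P] by blast
  define \<phi> where "\<phi> i k = lin_ext (rank Q i) (g i) (f i k) - unit_vec k" for i k
  have \<phi>_ext: "lin_ext (rank P i) (\<phi> i) v = lin_ext (rank Q i) (g i) (lin_ext (rank P i) (f i) v) - v"
    if "v \<in> chains P UNIV i" for i v
    using that lin_ext_unit_vec_right[of "rank P i" v]
    unfolding \<phi>_def lin_ext_diff_left by (simp add: lin_ext_comp chains_def)
  have "\<exists>h. (\<forall>i. \<forall>k<rank P i. h i k \<in> graded_chains P UNIV (Suc i) (gen_degree P i k)) \<and>
    (\<forall>i. \<forall>v \<in> chains P UNIV i. (i = 0 \<or> aug_cycle P i v) \<longrightarrow>
      boundary P i (lin_ext (rank P i) (h i) v) = lin_ext (rank P i) (\<phi> i) v)"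
  proof (rule null_homotopy[OF P])
    show "\<phi> i k \<in> graded_chains P UNIV i (gen_degree P i k)" if "k < rank P i" for i k
      unfolding \<phi>_def
      using that f(1) g(1) by (intro graded_chains_diff lin_ext_graded_chains unit_vec_graded_chains) auto
    show "augment P (lin_ext (rank P 0) (\<phi> 0) v) = 0" for v
    proof -
      have "lin_ext (rank P 0) (\<phi> 0) v
          = lin_ext (rank Q 0) (g 0) (lin_ext (rank P 0) (f 0) v) - lin_ext (rank P 0) unit_vec v"
        unfolding \<phi>_def lin_ext_diff_left by (simp add: lin_ext_comp)
      then show ?thesis
        by (simp add: augment_diff f(2) g(2)) (simp add: augment_lin_ext augment_unit_vec, simp add: augment_def)
    qed
    show "boundary P i (lin_ext (rank P (Suc i)) (\<phi> (Suc i)) v) = lin_ext (rank P i) (\<phi> i) (boundary P i v)"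
      if "v \<in> chains P UNIV (Suc i)" for i v
      using that boundary_chains[OF ring_module.subspace_UNIV that]
      by (simp add: \<phi>_ext boundary_diff f(3) g(3))
  qed
  then obtain h where h: "\<And>i k. k < rank P i \<Longrightarrow> h i k \<in> graded_chains P UNIV (Suc i) (gen_degree P i k)"
    "\<And>i v. v \<in> chains P UNIV i \<Longrightarrow> i = 0 \<or> aug_cycle P i v \<Longrightarrow>
      boundary P i (lin_ext (rank P i) (h i) v) = lin_ext (rank P i) (\<phi> i) v"
    by blast
  fix v assume v: "v \<in> tor_cycles P M i j"
  then have vM: "v \<in> graded_chains P M i j" by (simp add: tor_cycles_def)
  \<comment> \<open>The homotopy identity is known for chains over \<open>S\<close>; a chain with
    coordinates in \<open>M\<close> is one of them.\<close>
  then have vS: "v \<in> chains P UNIV i" by (auto simp: graded_chains_def chains_def)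
  let ?f = "lin_ext (rank P i) (f i) v"
  have "?f \<in> graded_chains Q M i j" using f(1) by (intro lin_ext_graded_chains[OF M vM]) auto
  then have "?f \<in> tor_cycles Q M i j"
    using v by (auto simp: tor_cycles_def f(3) split: nat.splits)
  then obtain w where w: "w \<in> graded_chains Q M (Suc i) j" "?f = boundary Q i w"
    using van by (auto simp: tor_boundaries_def)
  let ?u = "lin_ext (rank Q (Suc i)) (g (Suc i)) w - lin_ext (rank P i) (h i) v"
  have "?u \<in> graded_chains P M (Suc i) j"
    using g(1) h(1) by (intro graded_chains_diff[OF M] lin_ext_graded_chains[OF M] w vM) auto
  moreover have "boundary P i ?u = v"
  proof -
    have "i = 0 \<or> aug_cycle P i v"
      using v by (auto simp: tor_cycles_def aug_cycle_def split: nat.splits)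
    then show ?thesis
      by (simp add: boundary_diff g(3) h(2)[OF vS] \<phi>_ext[OF vS] flip: w(2))
  qed
  ultimately show "v \<in> tor_boundaries P M i j"
    unfolding tor_boundaries_def by (metis imageI)
qed

section \<open>Betti numbers and the vanishing of Tor\<close>

lemma sum_fun_apply: "sum f A x = (\<Sum>a\<in>A. f a x)"
  by (induct A rule: infinite_finite_induct) auto

lemma sum_monomials: "(\<Sum>a\<in>Poly_Mapping.keys f. Poly_Mapping.single a (coeff f a)) = f"
proof (rule poly_mapping_eqI)
  fix m
  have "coeff (\<Sum>a\<in>Poly_Mapping.keys f. Poly_Mapping.single a (coeff f a)) m
      = (\<Sum>a\<in>Poly_Mapping.keys f. if a = m then coeff f a else 0)"
    by (simp add: lookup_sum lookup_single when_def)
  then show "coeff (\<Sum>a\<in>Poly_Mapping.keys f. Poly_Mapping.single a (coeff f a)) m = coeff f m"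
    by (simp add: in_keys_iff)
qed

lemma homogeneous_part_scale:
  "f \<in> homogeneous_part d \<Longrightarrow> Poly_Mapping.single 0 c * f \<in> homogeneous_part d"
  using homogeneous_part_mult[of "Poly_Mapping.single 0 c" 0 f d] by (simp add: homogeneous_part_def)

lemma graded_chains_subspace:
  assumes "ring_module.subspace M"
  shows "chain_space.subspace (graded_chains P M i j)"
  using assms
  by (intro chain_space.subspaceI)
    (auto simp: graded_chains_def chains_def chain_scale_def homogeneous_part_add homogeneous_part_scale
      intro: ring_module.subspace_0 ring_module.subspace_add ring_module.subspace_scale)

lemma boundary_add: "boundary P i (v + w) = boundary P i v + boundary P i w"
  by (simp add: boundary_def fun_eq_iff distrib_left sum.distrib)

lemma boundary_scale: "boundary P i (chain_scale c v) = chain_scale c (boundary P i v)"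
  by (simp add: boundary_def chain_scale_def fun_eq_iff sum_distrib_left mult.left_commute)

lemma tor_cycles_subspace:
  assumes "ring_module.subspace M"
  shows "chain_space.subspace (tor_cycles P M i j)"
  using graded_chains_subspace[OF assms, of P i j]
  by (cases i) (auto simp: tor_cycles_def chain_space.subspace_def boundary_add boundary_scale)

lemma tor_boundaries_subspace:
  assumes "ring_module.subspace M"
  shows "chain_space.subspace (tor_boundaries P M i j)"
  unfolding tor_boundaries_def chain_space.subspace_def
proof (intro conjI ballI allI)
  note G = graded_chains_subspace[OF assms, of P "Suc i" j]
  show "0 \<in> boundary P i ` graded_chains P M (Suc i) j"
    using chain_space.subspace_0[OF G] boundary_zero by (metis imageI)
  show "x + y \<in> boundary P i ` graded_chains P M (Suc i) j"
    if "x \<in> boundary P i ` graded_chains P M (Suc i) j" "y \<in> boundary P i ` graded_chains P M (Suc i) j" for x y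
    using that chain_space.subspace_add[OF G] by (auto simp: boundary_add[symmetric])
  show "chain_scale c x \<in> boundary P i ` graded_chains P M (Suc i) j"
    if "x \<in> boundary P i ` graded_chains P M (Suc i) j" for c x
    using that chain_space.subspace_scale[OF G] by (auto simp: boundary_scale[symmetric])
qed

lemma tor_boundaries_subset_cycles:
  assumes P: "graded_free_resolution P" and M: "ring_module.subspace M"
  shows "tor_boundaries P M i j \<subseteq> tor_cycles P M i j"
proof
  fix v assume "v \<in> tor_boundaries P M i j"
  then obtain w where w: "w \<in> graded_chains P M (Suc i) j" "v = boundary P i w"
    by (auto simp: tor_boundaries_def)
  then have "v \<in> graded_chains P M i j"
    using boundary_graded_chains[OF P M] by simp
  moreover have "w \<in> chains P UNIV (Suc i)" using w(1) by (simp add: graded_chains_def chains_def)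
  then have "aug_cycle P i v" using aug_cycle_boundary[OF P] w(2) by simp
  ultimately show "v \<in> tor_cycles P M i j" by (auto simp: tor_cycles_def aug_cycle_def split: nat.splits)
qed

text \<open>A fixed degree contains finitely many monomials. Finite dimension matters because
  \<open>dim\<close> is a \<open>card\<close>, which is 0 for an infinite basis.\<close>

lemma graded_chains_finite_span:
  obtains B where "finite B" "graded_chains P M i j \<subseteq> chain_space.span B"
proof
  define e :: "nat \<times> ('a \<Rightarrow>\<^sub>0 nat) \<Rightarrow> nat \<Rightarrow> ('a, 'b) mpoly"
    where "e = (\<lambda>(k, a). (\<lambda>l. if l = k then Poly_Mapping.single a 1 else 0))"
  define S where "S = (SIGMA k:{..<rank P i}. {a :: 'a \<Rightarrow>\<^sub>0 nat. int (total_degree a) = j - gen_degree P i k})"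
  have "finite {a :: 'a \<Rightarrow>\<^sub>0 nat. int (total_degree a) = d}" for d
    by (rule finite_subset[OF _ finite_total_degree[of "nat d"]]) auto
  then show "finite (e ` S)" by (auto simp: S_def)
  show "graded_chains P M i j \<subseteq> chain_space.span (e ` S)"
  proof
    fix v assume v: "v \<in> graded_chains P M i j"
    let ?s = "\<Sum>k<rank P i. \<Sum>a\<in>Poly_Mapping.keys (v k). chain_scale (coeff (v k) a) (e (k, a))"
    have "?s l = v l" for l
    proof -
      have "?s l = (\<Sum>k<rank P i. \<Sum>a\<in>Poly_Mapping.keys (v k). chain_scale (coeff (v k) a) (e (k, a)) l)"
        by (simp add: sum_fun_apply)
      also have "\<dots> = (\<Sum>k<rank P i. if k = l then \<Sum>a\<in>Poly_Mapping.keys (v k). Poly_Mapping.single a (coeff (v k) a) else 0)"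
        by (intro sum.cong refl) (auto simp: chain_scale_def e_def mult_single)
      also have "\<dots> = v l"
        using v by (auto simp: sum_monomials graded_chains_def chains_def)
      finally show ?thesis .
    qed
    then have "v = ?s" by auto
    moreover have "?s \<in> chain_space.span (e ` S)"
    proof (intro chain_space.span_sum chain_space.span_scale chain_space.span_base imageI)
      fix k a assume "k \<in> {..<rank P i}" "a \<in> Poly_Mapping.keys (v k)"
      then show "(k, a) \<in> S"
        using v by (auto simp: S_def graded_chains_def homogeneous_part_def)
    qed
    ultimately show "v \<in> chain_space.span (e ` S)" by simp
  qed
qed

text \<open>A basis \<open>C\<close> of \<open>S\<close> extends to a basis \<open>D\<close> of
  \<open>T\<close>; \<open>C = D\<close> would put \<open>T\<close> inside \<open>span C\<close>,
  hence inside \<open>S\<close>. The finite spanning set makes the two cardinalities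
  comparable.\<close>

lemma (in vector_space) dim_strict_mono:
  assumes S: "subspace S" and T: "subspace T" and ST: "S \<subset> T" and fin: "finite B" "T \<subseteq> span B"
  shows "dim S < dim T"
proof -
  obtain C where C: "C \<subseteq> S" "independent C" "S \<subseteq> span C"
    using maximal_independent_subset by blast
  obtain D where D: "C \<subseteq> D" "D \<subseteq> T" "independent D" "T \<subseteq> span D"
    using maximal_independent_subset_extend[of C T] C ST by blast
  have "finite D" using independent_span_bound[OF fin(1) D(3)] D(2) fin(2) by blast
  moreover have "C \<noteq> D"
    using ST D(4) span_minimal[OF C(1) S] by blast
  ultimately have "card C < card D" using D(1) by (intro psubset_card_mono) auto
  then show ?thesis
    using basis_card_eq_dim[OF C(1,3,2)] basis_card_eq_dim[OF D(2,4,3)] by simp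
qed

text \<open>The Betti number is a truncated difference, but boundaries lie in cycles, so it vanishes
  exactly when the two spaces agree. A statement on dimensions over the chosen resolution becomes an
  inclusion that can be moved to \<open>Q\<close>.\<close>

lemma graded_betti_nonzero_iff:
  fixes Q :: "('n::finite, 'k::field) free_complex"
  assumes Q: "graded_free_resolution Q" and M: "ring_module.subspace M"
  shows "graded_betti M i j \<noteq> 0 \<longleftrightarrow> \<not> tor_cycles Q M i j \<subseteq> tor_boundaries Q M i j"
proof -
  \<comment> \<open>\<open>Q\<close> witnesses that the choice by \<open>SOME\<close> does yield a
    resolution.\<close>
  define P :: "('n, 'k) free_complex" where "P = (SOME P. graded_free_resolution P)"
  have P: "graded_free_resolution P" unfolding P_def using Q by (rule someI)
  have betti: "graded_betti M i j = chain_space.dim (tor_cycles P M i j) - chain_space.dim (tor_boundaries P M i j)"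
    by (simp add: graded_betti_def P_def Let_def)
  have "graded_betti M i j \<noteq> 0 \<longleftrightarrow> \<not> tor_cycles P M i j \<subseteq> tor_boundaries P M i j"
  proof
    assume "\<not> tor_cycles P M i j \<subseteq> tor_boundaries P M i j"
    then have "tor_boundaries P M i j \<subset> tor_cycles P M i j"
      using tor_boundaries_subset_cycles[OF P M] by blast
    moreover obtain B where "finite B" "graded_chains P M i j \<subseteq> chain_space.span B"
      using graded_chains_finite_span by blast
    moreover from this have "tor_cycles P M i j \<subseteq> chain_space.span B"
      by (auto simp: tor_cycles_def)
    ultimately have "chain_space.dim (tor_boundaries P M i j) < chain_space.dim (tor_cycles P M i j)"
      by (intro chain_space.dim_strict_mono tor_boundaries_subspace[OF M] tor_cycles_subspace[OF M])
    then show "graded_betti M i j \<noteq> 0"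
      by (simp add: betti)
  next
    assume "graded_betti M i j \<noteq> 0"
    then show "\<not> tor_cycles P M i j \<subseteq> tor_boundaries P M i j"
      using tor_boundaries_subset_cycles[OF P M, of i j] by (auto simp: betti)
  qed
  then show ?thesis
    using tor_vanishing_independent[OF P Q M] tor_vanishing_independent[OF Q P M] by blast
qed

section \<open>The Koszul complex in a fixed multidegree\<close>

text \<open>The sign of sorting \<open>t\<close> into its place in the wedge product of the elements
  of \<open>B\<close>.\<close>

definition ksign :: "'n::{finite,linorder} \<Rightarrow> 'n set \<Rightarrow> 'a::comm_ring_1"
  where "ksign t B = (-1) ^ card {s \<in> B. s < t}"

lemma ksign_square [simp]: "ksign t B * ksign t B = 1"
  by (simp add: ksign_def flip: power_add mult_2)

lemma ksign_insert:
  assumes "s \<notin> B"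
  shows "ksign t (insert s B) = (if s < t then - ksign t B else ksign t B)"
proof -
  have "{r \<in> insert s B. r < t} = (if s < t then insert s {r \<in> B. r < t} else {r \<in> B. r < t})" by auto
  then show ?thesis using assms by (simp add: ksign_def)
qed

text \<open>Exactly one of \<open>s < t\<close> and \<open>t < s\<close> holds, so exactly one of
  the two signs changes when the other element has been inserted before.\<close>

lemma ksign_swap:
  assumes "s \<notin> B" "t \<notin> B" "s \<noteq> t"
  shows "ksign s B * ksign t (insert s B) = - (ksign t B * ksign s (insert t B))"
  using assms by (auto simp: ksign_insert not_less_iff_gr_or_eq)

text \<open>The index is the number of vertices, one more than the usual dimension, so that it
  agrees with the homological degree in the Koszul complex. The empty set counts in index 0, as in
  reduced homology.\<close>

definition simplicial_chains :: "'n set set \<Rightarrow> nat \<Rightarrow> ('n set \<Rightarrow> 'k::zero) set"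
  where "simplicial_chains \<Delta> i = {z. \<forall>B. z B \<noteq> 0 \<longrightarrow> B \<in> \<Delta> \<and> card B = i}"

text \<open>Written by coefficients: the value at \<open>B\<close> collects the faces
  \<open>insert t B\<close> that have \<open>B\<close> in their boundary.\<close>

definition simplicial_boundary :: "('n::{finite,linorder} set \<Rightarrow> 'k::comm_ring_1) \<Rightarrow> 'n set \<Rightarrow> 'k"
  where "simplicial_boundary z = (\<lambda>B. \<Sum>t\<in>-B. ksign t B * z (insert t B))"

text \<open>A representative of a nonzero class in reduced homology of dimension
  \<open>i - 1\<close>; using representatives avoids quotient spaces.\<close>

definition essential_cycle :: "'n::{finite,linorder} set set \<Rightarrow> nat \<Rightarrow> ('n set \<Rightarrow> 'k::comm_ring_1) \<Rightarrow> bool"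
  where "essential_cycle \<Delta> i z \<longleftrightarrow> z \<in> simplicial_chains \<Delta> i \<and> simplicial_boundary z = 0
    \<and> z \<notin> simplicial_boundary ` simplicial_chains \<Delta> (Suc i)"

text \<open>Coning off at the apex \<open>t\<close> is a contracting homotopy.\<close>

lemma cone_no_essential_cycle:
  assumes apex: "\<And>B. insert t B \<in> \<Delta> \<longleftrightarrow> B \<in> \<Delta>"
  shows "\<not> essential_cycle \<Delta> i z"
proof
  assume ess: "essential_cycle \<Delta> i z"
  define w where "w = (\<lambda>B. if t \<in> B then ksign t (B - {t}) * z (B - {t}) else 0)"
  have "w \<in> simplicial_chains \<Delta> (Suc i)"
    unfolding simplicial_chains_def
  proof (intro CollectI allI impI)
    fix B assume "w B \<noteq> 0"
    then have B: "t \<in> B" "z (B - {t}) \<noteq> 0" by (auto simp: w_def split: if_splits)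
    then have "B - {t} \<in> \<Delta>" "card (B - {t}) = i"
      using ess by (auto simp: essential_cycle_def simplicial_chains_def)
    moreover have "card B = Suc (card (B - {t}))"
      using B(1) by (intro card.remove) auto
    moreover have "insert t (B - {t}) = B" using B(1) by auto
    ultimately show "B \<in> \<Delta> \<and> card B = Suc i"
      using apex[of "B - {t}"] by metis
  qed
  moreover have "simplicial_boundary w B = z B" for B
  proof (cases "t \<in> B")
    case False
    have "simplicial_boundary w B = (\<Sum>s\<in>-B. if s = t then z B else 0)"
      unfolding simplicial_boundary_def
      using False by (intro sum.cong refl) (auto simp: w_def simp flip: mult.assoc)
    then show ?thesis using False by simp
  next
    case True
    define A where "A = B - {t}"
    have A: "t \<notin> A" "B = insert t A" using True by (auto simp: A_def)
    \<comment> \<open>The cycle condition is read at \<open>A = B - {t}\<close>: the summand for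
      \<open>t\<close> gives back \<open>z B\<close>, and the others form the boundary of
      \<open>w\<close> at \<open>B\<close> with the opposite sign.\<close>
    have "0 = ksign t A * simplicial_boundary z A"
      using ess by (simp add: essential_cycle_def)
    also have "\<dots> = ksign t A * (\<Sum>s\<in>insert t (- B). ksign s A * z (insert s A))"
      unfolding simplicial_boundary_def using A by (intro arg_cong2[where f="(*)"] refl sum.cong) auto
    also have "\<dots> = z B + (\<Sum>s\<in>-B. ksign t A * (ksign s A * z (insert s A)))"
      using A by (simp add: sum_distrib_left algebra_simps) (simp flip: mult.assoc)
    also have "(\<Sum>s\<in>-B. ksign t A * (ksign s A * z (insert s A))) = - simplicial_boundary w B"
      unfolding simplicial_boundary_def sum_negf[symmetric]
    proof (intro sum.cong refl)
      fix s assume "s \<in> - B"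
      then have s: "s \<noteq> t" "s \<notin> A" using A by auto
      have "w (insert s B) = ksign t (insert s A) * z (insert s A)"
      proof -
        have "insert s B - {t} = insert s A" using A s by auto
        then show ?thesis using A by (simp add: w_def)
      qed
      moreover have "ksign t A * ksign s A = - (ksign s (insert t A) * ksign t (insert s A) :: 'b)"
        using A s by (auto simp: ksign_insert not_less_iff_gr_or_eq mult.commute)
      ultimately show "ksign t A * (ksign s A * z (insert s A)) = - (ksign s B * w (insert s B))"
        by (simp add: A(2) flip: mult.assoc)
    qed
    finally show ?thesis by simp
  qed
  then have "simplicial_boundary w = z" by auto
  ultimately show False using ess by (auto simp: essential_cycle_def)
qed

text \<open>Adding \<open>s\<close> and then \<open>t\<close> contributes the negative of adding
  \<open>t\<close> and then \<open>s\<close>.\<close>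

lemma simplicial_boundary_boundary: "simplicial_boundary (simplicial_boundary z) = 0"
proof
  fix B :: "'a set"
  define g where "g s t = ksign s B * ksign t (insert s B) * z (insert t (insert s B))" for s t
  have anti: "g t s = - g s t" if "s \<notin> B" "t \<notin> B" "s \<noteq> t" for s t
    using ksign_swap[OF that, where ?'b='b] by (simp add: g_def insert_commute)
  have "simplicial_boundary (simplicial_boundary z) B = (\<Sum>s\<in>-B. \<Sum>t\<in>-B - {s}. g s t)"
    unfolding simplicial_boundary_def sum_distrib_left g_def mult.assoc
    by (intro sum.cong refl) auto
  \<comment> \<open>Antisymmetry of \<open>g\<close> alone would only show that twice the sum is
    zero. Splitting by the order of \<open>s\<close> and \<open>t\<close> cancels each pair once and
    is valid in characteristic 2.\<close>
  also have "\<dots> = (\<Sum>s\<in>-B. (\<Sum>t\<in>{t\<in>-B. t < s}. g s t) + (\<Sum>t\<in>{t\<in>-B. s < t}. g s t))"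
  proof (intro sum.cong refl)
    fix s
    have *: "-B - {s} = {t\<in>-B. t < s} \<union> {t\<in>-B. s < t}" by auto
    show "(\<Sum>t\<in>-B - {s}. g s t) = (\<Sum>t\<in>{t\<in>-B. t < s}. g s t) + (\<Sum>t\<in>{t\<in>-B. s < t}. g s t)"
      unfolding * by (rule sum.union_disjoint) auto
  qed
  also have "\<dots> = (\<Sum>s\<in>-B. \<Sum>t\<in>{t\<in>-B. t < s}. g s t) + (\<Sum>s\<in>-B. \<Sum>t\<in>{t\<in>-B. s < t}. g s t)"
    by (rule sum.distrib)
  also have "(\<Sum>s\<in>-B. \<Sum>t\<in>{t\<in>-B. s < t}. g s t) = (\<Sum>t\<in>-B. \<Sum>s\<in>{s\<in>-B. s < t}. g s t)"
    by (rule sum.swap_restrict) auto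
  also have "\<dots> = (\<Sum>t\<in>-B. \<Sum>s\<in>{s\<in>-B. s < t}. - g t s)"
    by (intro sum.cong refl) (rule anti, auto)
  finally show "simplicial_boundary (simplicial_boundary z) B = 0 B"
    by (simp add: sum_negf)
qed

text \<open>In index n or more only the full set can carry a coefficient, and the boundary at the
  complement of a single variable is that coefficient up to sign. Such a cycle is therefore 0, which
  is a boundary. This is the source of n - 1 in the final bound.\<close>

lemma essential_cycle_degree:
  assumes "essential_cycle \<Delta> i (z :: 'n::{finite,linorder} set \<Rightarrow> 'k::comm_ring_1)"
  shows "i < CARD('n)"
proof (rule ccontr)
  assume "\<not> i < CARD('n)"
  have z: "z \<in> simplicial_chains \<Delta> i" "simplicial_boundary z = 0"
    using assms by (auto simp: essential_cycle_def)
  have top: "z B = 0" if "B \<noteq> UNIV" for B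
  proof -
    have "card B < CARD('n)" using that by (intro psubset_card_mono) auto
    then show ?thesis using z(1) \<open>\<not> i < CARD('n)\<close> by (auto simp: simplicial_chains_def)
  qed
  moreover have "z UNIV = 0"
  proof -
    fix t :: 'n
    have "0 = simplicial_boundary z (UNIV - {t})" using z by simp
    also have "\<dots> = ksign t (UNIV - {t}) * z UNIV"
    proof -
      have "- (UNIV - {t}) = {t}" by auto
      then show ?thesis by (simp add: simplicial_boundary_def insert_absorb)
    qed
    finally have "ksign t (UNIV - {t}) * (ksign t (UNIV - {t}) * z UNIV) = 0" by simp
    then show ?thesis by (simp flip: mult.assoc)
  qed
  ultimately have "z B = 0" for B by (cases "B = UNIV") auto
  then have "z = 0" by auto
  moreover have "(0 :: 'n set \<Rightarrow> 'k) = simplicial_boundary 0" by (simp add: simplicial_boundary_def fun_eq_iff)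
  moreover have "(0 :: 'n set \<Rightarrow> 'k) \<in> simplicial_chains \<Delta> (Suc i)" by (simp add: simplicial_chains_def)
  ultimately show False using assms unfolding essential_cycle_def by blast
qed

text \<open>The complex whose only face is the empty set has homology in dimension -1; it will
  account for a generator of an ideal.\<close>

lemma essential_cycle_point:
  "essential_cycle {{}} 0 (\<lambda>B :: 'n::{finite,linorder} set. if B = {} then 1 else 0 :: 'k::comm_ring_1)"
proof -
  have "simplicial_chains {{}} (Suc 0) = {0 :: 'n set \<Rightarrow> 'k}"
    by (force simp: simplicial_chains_def fun_eq_iff)
  moreover have "simplicial_boundary (0 :: 'n set \<Rightarrow> 'k) = 0"
    by (simp add: simplicial_boundary_def fun_eq_iff)
  ultimately show ?thesis
    by (auto simp: essential_cycle_def simplicial_chains_def simplicial_boundary_def fun_eq_iff)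
qed

section \<open>Splitting Koszul chains by multidegree\<close>

definition ind :: "'n set \<Rightarrow> 'n::finite \<Rightarrow>\<^sub>0 nat"
  where "ind B = (\<Sum>t\<in>B. Poly_Mapping.single t 1)"

lemma lookup_ind: "Poly_Mapping.lookup (ind B) t = (if t \<in> B then 1 else 0)"
  by (simp add: ind_def lookup_sum lookup_single when_def)

lemma ind_insert: "t \<notin> B \<Longrightarrow> ind (insert t B) = Poly_Mapping.single t 1 + ind B"
  by (simp add: ind_def)

lemma ind_empty [simp]: "ind {} = 0"
  by (simp add: ind_def)

lemma total_degree_ind: "total_degree (ind B) = card B"
proof -
  have "total_degree (ind B) = (\<Sum>t\<in>UNIV. if t \<in> B then 1 else 0)"
    by (simp add: total_degree_def lookup_ind)
  also have "\<dots> = card B" by (subst sum.inter_restrict[symmetric]) auto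
  finally show ?thesis .
qed

text \<open>The upper Koszul complex of a monomial ideal with exponent set \<open>U\<close>.
  Divisibility is phrased by addition because subtraction of exponents truncates at 0.\<close>

definition exponent_complex :: "('n::finite \<Rightarrow>\<^sub>0 nat) set \<Rightarrow> ('n \<Rightarrow>\<^sub>0 nat) \<Rightarrow> 'n set set"
  where "exponent_complex U a = {B. \<exists>m\<in>U. a = m + ind B}"

text \<open>The basis vector of \<open>B\<close> has multidegree \<open>ind B\<close>, so the part
  of multidegree \<open>a\<close> reads its coefficient at \<open>a - ind B\<close>. The case split
  discards the value of a truncated subtraction when \<open>ind B\<close> is not below
  \<open>a\<close>.\<close>

definition slice :: "('n set \<Rightarrow> ('n::finite, 'k::zero) mpoly) \<Rightarrow> ('n \<Rightarrow>\<^sub>0 nat) \<Rightarrow> 'n set \<Rightarrow> 'k"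
  where "slice c a = (\<lambda>B. if \<exists>m. a = m + ind B then coeff (c B) (a - ind B) else 0)"

lemma slice_add [simp]: "slice c (m + ind B) B = coeff (c B) m"
  by (auto simp: slice_def)

lemma slice_outside: "(\<And>m. a \<noteq> m + ind B) \<Longrightarrow> slice c a B = 0"
  by (auto simp: slice_def)

lemma slice_eqI:
  assumes "\<And>a. slice c a = slice d a" shows "c = d"
proof (intro ext poly_mapping_eqI)
  fix B m show "coeff (c B) m = coeff (d B) m"
    using assms[of "m + ind B"] slice_add by metis
qed

definition koszul_boundary :: "('n::{finite,linorder} set \<Rightarrow> ('n, 'k::comm_ring_1) mpoly) \<Rightarrow> 'n set \<Rightarrow> ('n, 'k) mpoly"
  where "koszul_boundary c = (\<lambda>B. \<Sum>t\<in>-B. ksign t B * (var t * c (insert t B)))"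

lemma coeff_ksign_mult: "coeff (ksign t B * f) m = ksign t B * coeff (f :: ('n, 'k::comm_ring_1) mpoly) m"
  by (cases "even (card {s \<in> B. s < t})") (simp_all add: ksign_def)

text \<open>Replacing the vector of \<open>insert t B\<close> by \<open>var t\<close> times that of
  \<open>B\<close> keeps the multidegree, so the differential never mixes slices.\<close>

lemma slice_koszul_boundary: "slice (koszul_boundary c) a = simplicial_boundary (slice c a)"
proof
  fix B
  show "slice (koszul_boundary c) a B = simplicial_boundary (slice c a) B"
  proof (cases "\<exists>m. a = m + ind B")
    case True
    then obtain m where m: "a = m + ind B" by blast
    have "coeff (var t * c (insert t B)) m = slice c a (insert t B)" if t: "t \<notin> B" for t
    proof (cases "\<exists>m'. m = Poly_Mapping.single t 1 + m'")
      case True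
      then obtain m' where m': "m = Poly_Mapping.single t 1 + m'" by blast
      then have "a = m' + ind (insert t B)" using m ind_insert[OF t] by (simp add: ac_simps)
      then show ?thesis by (simp add: m' var_def coeff_mult_single_plus)
    next
      case False
      then have "coeff (var t * c (insert t B)) m = 0"
        unfolding var_def by (intro coeff_mult_single_eq_0) auto
      moreover have "slice c a (insert t B) = 0"
        using False by (intro slice_outside) (auto simp: m ind_insert[OF t] simp flip: add.assoc, metis add.commute)
      ultimately show ?thesis by simp
    qed
    then show ?thesis
      by (simp add: m koszul_boundary_def simplicial_boundary_def lookup_sum coeff_ksign_mult)
  next
    case False
    then have "slice c a (insert t B) = 0" if "t \<notin> B" for t
      using ind_insert[OF that] by (intro slice_outside) (metis add.assoc)
    then show ?thesis
      using False by (simp add: simplicial_boundary_def slice_outside)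
  qed
qed

definition koszul_chains :: "('n::finite \<Rightarrow>\<^sub>0 nat) set \<Rightarrow> nat \<Rightarrow> ('n set \<Rightarrow> ('n, 'k::zero) mpoly) set"
  where "koszul_chains U i = {c. \<forall>B. Poly_Mapping.keys (c B) \<subseteq> U \<and> (card B \<noteq> i \<longrightarrow> c B = 0)}"

lemma slice_simplicial_chains:
  assumes "c \<in> koszul_chains U i"
  shows "slice c a \<in> simplicial_chains (exponent_complex U a) i"
  unfolding simplicial_chains_def
proof (intro CollectI allI impI)
  fix B assume "slice c a B \<noteq> 0"
  then obtain m where m: "a = m + ind B" "coeff (c B) m \<noteq> 0"
    using slice_outside slice_add by metis
  then have "m \<in> U" "card B = i"
    using assms by (auto simp: koszul_chains_def in_keys_iff subset_iff)
  then show "B \<in> exponent_complex U a \<and> card B = i"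
    using m(1) by (auto simp: exponent_complex_def)
qed

text \<open>Inverse to slicing: prescribed parts in all multidegrees are assembled into one chain.
  \<open>Abs_poly_mapping\<close> is meaningful when only finitely many parts are nonzero.\<close>

definition glue :: "(('n::finite \<Rightarrow>\<^sub>0 nat) \<Rightarrow> 'n set \<Rightarrow> 'k::zero) \<Rightarrow> 'n set \<Rightarrow> ('n, 'k) mpoly"
  where "glue w B = Poly_Mapping.Abs_poly_mapping (\<lambda>m. w (m + ind B) B)"

text \<open>For fixed \<open>B\<close> the multidegree \<open>m + ind B\<close> determines
  \<open>m\<close>, so finitely many nonzero parts leave finitely many terms in each
  coordinate.\<close>

lemma
  assumes fin: "finite {a. w a \<noteq> 0}"
    and w: "\<And>a. w a \<in> simplicial_chains (exponent_complex U a) i"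
  shows slice_glue: "slice (glue w) a = w a"
    and glue_koszul_chains: "glue w \<in> koszul_chains U i"
proof -
  have "finite {m. w (m + ind B) B \<noteq> 0}" for B
  proof (rule finite_imageD)
    show "finite ((\<lambda>m. m + ind B) ` {m. w (m + ind B) B \<noteq> 0})"
      by (rule finite_subset[OF _ fin]) auto
  qed (auto intro: inj_onI)
  then have coeff: "coeff (glue w B) m = w (m + ind B) B" for B m
    by (simp add: glue_def)
  have supp: "w a B \<noteq> 0 \<Longrightarrow> (\<exists>m\<in>U. a = m + ind B) \<and> card B = i" for a B
    using w[of a] by (auto simp: simplicial_chains_def exponent_complex_def)
  show "slice (glue w) a = w a"
  proof
    fix B show "slice (glue w) a B = w a B"
    proof (cases "\<exists>m. a = m + ind B")
      case True
      then show ?thesis by (auto simp: coeff)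
    next
      case False
      then show ?thesis using supp slice_outside by metis
    qed
  qed
  show "glue w \<in> koszul_chains U i"
    unfolding koszul_chains_def
  proof (intro CollectI allI conjI impI subsetI)
    fix B m assume "m \<in> Poly_Mapping.keys (glue w B)"
    then show "m \<in> U" using supp[of "m + ind B" B] by (auto simp: in_keys_iff coeff)
  next
    fix B :: "'a set" assume "card B \<noteq> i"
    then show "glue w B = 0" using supp by (intro poly_mapping_eqI) (auto simp: coeff)
  qed
qed

lemma finite_slices:
  assumes "c \<in> koszul_chains U i"
  shows "finite {a. slice c a \<noteq> 0}"
proof (rule finite_subset)
  show "{a. slice c a \<noteq> 0} \<subseteq> (\<Union>B. (\<lambda>m. m + ind B) ` Poly_Mapping.keys (c B))"
  proof
    fix a assume "a \<in> {a. slice c a \<noteq> 0}"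
    then obtain B where "slice c a B \<noteq> 0" by (auto simp: fun_eq_iff)
    then obtain m where "a = m + ind B" "coeff (c B) m \<noteq> 0"
      using slice_outside slice_add by metis
    then show "a \<in> (\<Union>B. (\<lambda>m. m + ind B) ` Poly_Mapping.keys (c B))"
      by (auto simp: in_keys_iff intro!: image_eqI[of _ _ m] exI[of _ B])
  qed
qed auto

text \<open>Each slice is bounded separately and the results are glued. Choosing 0 wherever the
  slice of \<open>c\<close> is 0 makes the family finite and keeps the preimage in the degrees of
  \<open>c\<close>.\<close>

lemma koszul_exact:
  fixes c :: "'n::{finite,linorder} set \<Rightarrow> ('n, 'k::comm_ring_1) mpoly"
  assumes c: "c \<in> koszul_chains U i" "koszul_boundary c = 0"
    and ess: "\<And>a. slice c a \<noteq> 0 \<Longrightarrow> \<not> essential_cycle (exponent_complex U a) i (slice c a)"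
  shows "\<exists>d \<in> koszul_chains U (Suc i). koszul_boundary d = c \<and> (\<forall>a. slice d a \<noteq> 0 \<longrightarrow> slice c a \<noteq> 0)"
proof -
  have "\<exists>w. w \<in> simplicial_chains (exponent_complex U a) (Suc i) \<and> simplicial_boundary w = slice c a
    \<and> (slice c a = 0 \<longrightarrow> w = 0)" for a
  proof (cases "slice c a = 0")
    case True
    then show ?thesis
      by (intro exI[of _ 0]) (auto simp: simplicial_chains_def simplicial_boundary_def fun_eq_iff)
  next
    case False
    have "simplicial_boundary (slice c a) = 0"
      using c(2) by (simp flip: slice_koszul_boundary) (simp add: slice_def fun_eq_iff)
    then have "slice c a \<in> simplicial_boundary ` simplicial_chains (exponent_complex U a) (Suc i)"
      using ess[OF False] slice_simplicial_chains[OF c(1)] by (auto simp: essential_cycle_def)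
    then show ?thesis using False by auto
  qed
  then obtain w where w: "\<And>a. w a \<in> simplicial_chains (exponent_complex U a) (Suc i)"
    "\<And>a. simplicial_boundary (w a) = slice c a" "\<And>a. slice c a = 0 \<Longrightarrow> w a = 0"
    by metis
  have fin: "finite {a. w a \<noteq> 0}"
    by (rule finite_subset[OF _ finite_slices[OF c(1)]]) (use w(3) in auto)
  note G = slice_glue[OF fin w(1)] glue_koszul_chains[OF fin w(1)]
  have "koszul_boundary (glue w) = c"
    by (rule slice_eqI) (simp add: slice_koszul_boundary G w)
  moreover have "slice (glue w) a \<noteq> 0 \<longrightarrow> slice c a \<noteq> 0" for a
    using w(3) by (auto simp: G)
  ultimately show ?thesis using G(2) by blast
qed

definition graded_koszul_chains ::
    "('n::finite \<Rightarrow>\<^sub>0 nat) set \<Rightarrow> nat \<Rightarrow> int \<Rightarrow> ('n set \<Rightarrow> ('n, 'k::zero) mpoly) set"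
  where "graded_koszul_chains U i j = {c \<in> koszul_chains U i. \<forall>a. slice c a \<noteq> 0 \<longrightarrow> int (total_degree a) = j}"

text \<open>If every nonzero slice bounds, so does the chain. Conversely, an essential cycle put
  into its own multidegree, with zero elsewhere, cannot bound, since a slice of the bounding chain
  would bound it.\<close>

lemma koszul_homology_multigraded:
  "(\<exists>c :: 'n::{finite,linorder} set \<Rightarrow> ('n, 'k::comm_ring_1) mpoly. c \<in> graded_koszul_chains U i j \<and> koszul_boundary c = 0
      \<and> c \<notin> koszul_boundary ` graded_koszul_chains U (Suc i) j)
    \<longleftrightarrow> (\<exists>a (z :: 'n set \<Rightarrow> 'k). int (total_degree a) = j \<and> essential_cycle (exponent_complex U a) i z)"
  (is "?lhs \<longleftrightarrow> ?rhs")
proof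
  assume ?lhs
  then obtain c :: "'n set \<Rightarrow> ('n, 'k) mpoly" where c: "c \<in> koszul_chains U i" "koszul_boundary c = 0"
    "\<And>a. slice c a \<noteq> 0 \<Longrightarrow> int (total_degree a) = j" "c \<notin> koszul_boundary ` graded_koszul_chains U (Suc i) j"
    by (auto simp: graded_koszul_chains_def)
  show ?rhs
  proof (rule ccontr)
    assume "\<not> ?rhs"
    then obtain d where "d \<in> koszul_chains U (Suc i)" "koszul_boundary d = c" "\<And>a. slice d a \<noteq> 0 \<Longrightarrow> slice c a \<noteq> 0"
      using koszul_exact[OF c(1,2)] c(3) by blast
    then have "d \<in> graded_koszul_chains U (Suc i) j" using c(3) by (simp add: graded_koszul_chains_def)
    then show False using c(4) \<open>koszul_boundary d = c\<close> by blast
  qed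
next
  assume ?rhs
  then obtain a and z :: "'n set \<Rightarrow> 'k" where a: "int (total_degree a) = j"
    and z: "essential_cycle (exponent_complex U a) i z" by blast
  define w where "w b = (if b = a then z else 0)" for b
  have fin: "finite {b. w b \<noteq> 0}" by (rule finite_subset[of _ "{a}"]) (auto simp: w_def)
  have w: "w b \<in> simplicial_chains (exponent_complex U b) i" for b
    using z by (auto simp: w_def essential_cycle_def simplicial_chains_def)
  note G = slice_glue[OF fin w] glue_koszul_chains[OF fin w]
  have "glue w \<in> graded_koszul_chains U i j"
    using G a by (auto simp: graded_koszul_chains_def) (auto simp: w_def split: if_splits)
  moreover have "koszul_boundary (glue w) = 0"
  proof (rule slice_eqI)
    fix b
    have "simplicial_boundary (w b) = 0"
      using z by (auto simp: w_def essential_cycle_def simplicial_boundary_def fun_eq_iff)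
    then show "slice (koszul_boundary (glue w)) b = slice 0 b"
      by (simp add: slice_koszul_boundary G) (simp add: slice_def fun_eq_iff)
  qed
  moreover have "glue w \<notin> koszul_boundary ` graded_koszul_chains U (Suc i) j"
  proof
    assume "glue w \<in> koszul_boundary ` graded_koszul_chains U (Suc i) j"
    then obtain d where d: "d \<in> koszul_chains U (Suc i)" "glue w = koszul_boundary d"
      by (auto simp: graded_koszul_chains_def)
    have "z = slice (glue w) a" by (simp add: G w_def)
    also have "\<dots> = simplicial_boundary (slice d a)" by (simp add: d(2) slice_koszul_boundary)
    finally show False using z slice_simplicial_chains[OF d(1)] by (auto simp: essential_cycle_def)
  qed
  ultimately show ?lhs by blast
qed

section \<open>The Koszul complex as a resolution\<close>

definition supported_on :: "('n \<Rightarrow>\<^sub>0 nat) set \<Rightarrow> ('n, 'k::zero) mpoly set"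
  where "supported_on U = {f. Poly_Mapping.keys f \<subseteq> U}"

text \<open>A \<open>free_complex\<close> numbers its basis vectors, whereas the Koszul basis is
  indexed by subsets; any bijection will do.\<close>

definition subset_enum :: "nat \<Rightarrow> nat \<Rightarrow> 'n::finite set"
  where "subset_enum i = (SOME e. bij_betw e {..<card {B :: 'n set. card B = i}} {B. card B = i})"

lemma bij_subset_enum: "bij_betw (subset_enum i) {..<card {B :: 'n::finite set. card B = i}} {B :: 'n set. card B = i}"
proof -
  have "\<exists>e. bij_betw e {..<card {B :: 'n set. card B = i}} {B :: 'n set. card B = i}"
    using ex_bij_betw_nat_finite[of "{B :: 'n set. card B = i}"] by (simp add: atLeast0LessThan)
  then show ?thesis unfolding subset_enum_def by (rule someI_ex)
qed

text \<open>A generator at index \<open>i\<close> has degree \<open>i\<close>, the size of its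
  subset. The sum in the differential has at most one nonzero term, for the \<open>t\<close> missing
  from the smaller set; it expresses the matrix entry without naming that \<open>t\<close>.\<close>

definition koszul_complex :: "('n::{finite,linorder}, 'k::field) free_complex"
  where "koszul_complex =
    \<lparr>rank = (\<lambda>i. card {B :: 'n set. card B = i}),
     gen_degree = (\<lambda>i k. int i),
     differential = (\<lambda>i l k. \<Sum>t\<in>- subset_enum i l.
       if subset_enum (Suc i) k = insert t (subset_enum i l) then ksign t (subset_enum i l) * var t else 0),
     augmentation = (\<lambda>k. 1)\<rparr>"

lemma rank_koszul: "rank (koszul_complex :: ('n::{finite,linorder}, 'k::field) free_complex) i = card {B :: 'n set. card B = i}"
  by (simp add: koszul_complex_def)

lemma gen_degree_koszul [simp]: "gen_degree koszul_complex i k = int i"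
  by (simp add: koszul_complex_def)

lemma subset_enum_cases:
  assumes "card (B :: 'n::{finite,linorder} set) = i"
  obtains k where "k < rank (koszul_complex :: ('n, 'k::field) free_complex) i" "B = subset_enum i k"
  using bij_subset_enum[of i, where ?'n='n] assms that
  by (auto simp: rank_koszul bij_betw_def image_iff set_eq_iff)

lemma card_subset_enum:
  "k < rank (koszul_complex :: ('n::{finite,linorder}, 'k::field) free_complex) i \<Longrightarrow> card (subset_enum i k :: 'n set) = i"
  using bij_betwE[OF bij_subset_enum[of i, where ?'n='n]] by (auto simp: rank_koszul)

lemma subset_enum_inject:
  assumes "k < rank (koszul_complex :: ('n::{finite,linorder}, 'k::field) free_complex) i"
    "l < rank (koszul_complex :: ('n, 'k) free_complex) i"
  shows "subset_enum i k = (subset_enum i l :: 'n set) \<longleftrightarrow> k = l"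
  using assms unfolding rank_koszul
  by (intro inj_on_eq_iff[OF bij_betw_imp_inj_on[OF bij_subset_enum]]) auto

text \<open>The dictionary from numbered coordinates to functions on subsets; at most one summand
  survives, and off cardinality \<open>i\<close> none does.\<close>

definition by_subsets :: "nat \<Rightarrow> (nat \<Rightarrow> ('n::{finite,linorder}, 'k::field) mpoly) \<Rightarrow> 'n set \<Rightarrow> ('n, 'k) mpoly"
  where "by_subsets i v = (\<lambda>B. \<Sum>k<rank (koszul_complex :: ('n, 'k) free_complex) i. if B = subset_enum i k then v k else 0)"

lemma by_subsets_enum:
  assumes "k < rank (koszul_complex :: ('n::{finite,linorder}, 'k::field) free_complex) i"
  shows "by_subsets i (v :: nat \<Rightarrow> ('n, 'k) mpoly) (subset_enum i k) = v k"
proof -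
  have "by_subsets i v (subset_enum i k) = (\<Sum>l<rank (koszul_complex :: ('n, 'k) free_complex) i. if l = k then v l else 0)"
    unfolding by_subsets_def using assms by (intro sum.cong refl) (auto simp: subset_enum_inject)
  then show ?thesis using assms by simp
qed

lemma by_subsets_outside: "card B \<noteq> i \<Longrightarrow> by_subsets i v B = 0"
  unfolding by_subsets_def using card_subset_enum by (intro sum.neutral) auto

lemma by_subsets_inject:
  fixes v w :: "nat \<Rightarrow> ('n::{finite,linorder}, 'k::field) mpoly"
  assumes "v \<in> chains koszul_complex UNIV i" "w \<in> chains koszul_complex UNIV i" "by_subsets i v = by_subsets i w"
  shows "v = w"
proof
  fix k show "v k = w k"
  proof (cases "k < rank (koszul_complex :: ('n, 'k) free_complex) i")
    case True
    then show ?thesis using assms(3) by_subsets_enum by metis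
  next
    case False
    then show ?thesis using assms(1,2) by (simp add: chains_def)
  qed
qed

lemma by_subsets_surj:
  fixes c :: "'n::{finite,linorder} set \<Rightarrow> ('n, 'k::field) mpoly"
  assumes c: "c \<in> koszul_chains UNIV i"
  shows "\<exists>v \<in> chains koszul_complex UNIV i. by_subsets i v = c"
proof
  define v where "v k = (if k < rank (koszul_complex :: ('n, 'k) free_complex) i then c (subset_enum i k) else 0)" for k
  show "v \<in> chains koszul_complex UNIV i" by (simp add: chains_def v_def)
  show "by_subsets i v = c"
  proof
    fix B show "by_subsets i v B = c B"
    proof (cases "card B = i")
      case True
      then obtain k where k: "k < rank (koszul_complex :: ('n, 'k) free_complex) i" "B = subset_enum i k"
        by (rule subset_enum_cases)
      then show ?thesis by (simp add: by_subsets_enum) (simp add: v_def)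
    next
      case False
      then show ?thesis using c by (simp add: by_subsets_outside koszul_chains_def)
    qed
  qed
qed

lemma by_subsets_chains_iff:
  fixes v :: "nat \<Rightarrow> ('n::{finite,linorder}, 'k::field) mpoly"
  assumes v: "v \<in> chains koszul_complex UNIV i"
  shows "by_subsets i v \<in> koszul_chains U i \<longleftrightarrow> v \<in> chains koszul_complex (supported_on U) i"
proof
  assume "by_subsets i v \<in> koszul_chains U i"
  then have "Poly_Mapping.keys (by_subsets i v (subset_enum i k)) \<subseteq> U" for k
    by (simp add: koszul_chains_def)
  then have "Poly_Mapping.keys (v k) \<subseteq> U" if "k < rank (koszul_complex :: ('n, 'k) free_complex) i" for k
    using by_subsets_enum[OF that, of v] by metis
  then show "v \<in> chains koszul_complex (supported_on U) i"
    using v by (simp add: chains_def supported_on_def)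
next
  assume *: "v \<in> chains koszul_complex (supported_on U) i"
  have "Poly_Mapping.keys (by_subsets i v B) \<subseteq> U" if B: "card B = i" for B
  proof -
    obtain k where "k < rank (koszul_complex :: ('n, 'k) free_complex) i" "B = subset_enum i k"
      by (rule subset_enum_cases[OF B])
    then show ?thesis using * by (simp add: by_subsets_enum chains_def supported_on_def)
  qed
  then show "by_subsets i v \<in> koszul_chains U i"
    by (auto simp: koszul_chains_def by_subsets_outside) (metis by_subsets_outside keys_zero empty_iff subsetD)
qed

text \<open>A term \<open>m\<close> at \<open>B\<close> has multidegree \<open>m + ind B\<close>,
  and \<open>ind B\<close> adds \<open>card B = i\<close> to its total degree, which is exactly the
  shift \<open>gen_degree\<close>.\<close>

lemma by_subsets_graded_iff:
  fixes v :: "nat \<Rightarrow> ('n::{finite,linorder}, 'k::field) mpoly"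
  assumes v: "v \<in> chains koszul_complex UNIV i"
  shows "by_subsets i v \<in> graded_koszul_chains U i j \<longleftrightarrow> v \<in> graded_chains koszul_complex (supported_on U) i j"
proof -
  have "(\<forall>a. slice (by_subsets i v) a \<noteq> 0 \<longrightarrow> int (total_degree a) = j)
    \<longleftrightarrow> (\<forall>k<rank (koszul_complex :: ('n, 'k) free_complex) i. v k \<in> homogeneous_part (j - int i))" (is "?l \<longleftrightarrow> ?r")
  proof
    assume l: ?l
    show ?r unfolding homogeneous_part_def
    proof (intro allI impI CollectI ballI)
      fix k m assume k: "k < rank (koszul_complex :: ('n, 'k) free_complex) i" and m: "m \<in> Poly_Mapping.keys (v k)"
      have "slice (by_subsets i v) (m + ind (subset_enum i k)) (subset_enum i k) \<noteq> 0"
        using m by (simp add: by_subsets_enum[OF k] in_keys_iff)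
      then have "slice (by_subsets i v) (m + ind (subset_enum i k)) \<noteq> 0" by (rule contrapos_nn) simp
      then have "int (total_degree (m + ind (subset_enum i k :: 'n set))) = j" using l by blast
      then show "int (total_degree m) = j - int i"
        by (simp add: total_degree_add total_degree_ind card_subset_enum[OF k])
    qed
  next
    assume r: ?r
    show ?l
    proof (intro allI impI)
      fix a assume "slice (by_subsets i v) a \<noteq> 0"
      then obtain B where "slice (by_subsets i v) a B \<noteq> 0" by (auto simp: fun_eq_iff)
      then obtain m where m: "a = m + ind B" "coeff (by_subsets i v B) m \<noteq> 0"
        using slice_outside slice_add by metis
      then have "card B = i" using by_subsets_outside[of B i v] by (cases "card B = i") auto
      then obtain k where k: "k < rank (koszul_complex :: ('n, 'k) free_complex) i" "B = subset_enum i k"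
        by (rule subset_enum_cases)
      then have "m \<in> Poly_Mapping.keys (v k)" using m by (simp add: by_subsets_enum in_keys_iff)
      then have "int (total_degree m) = j - int i" using r k(1) by (auto simp: homogeneous_part_def)
      then show "int (total_degree a) = j"
        using \<open>card B = i\<close> by (simp add: m(1) total_degree_add total_degree_ind)
    qed
  qed
  then show ?thesis
    using by_subsets_chains_iff[OF v, of U] by (simp add: graded_koszul_chains_def graded_chains_def)
qed

lemma koszul_boundary_by_subsets:
  fixes v :: "nat \<Rightarrow> ('n::{finite,linorder}, 'k::field) mpoly"
  shows "koszul_boundary (by_subsets (Suc i) v) = by_subsets i (boundary koszul_complex i v)"
proof
  fix B
  show "koszul_boundary (by_subsets (Suc i) v) B = by_subsets i (boundary koszul_complex i v) B"
  proof (cases "card B = i")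
    case True
    then obtain l where l: "l < rank (koszul_complex :: ('n, 'k) free_complex) i" "B = subset_enum i l"
      by (rule subset_enum_cases)
    have "by_subsets i (boundary koszul_complex i v) B
        = (\<Sum>k<rank (koszul_complex :: ('n, 'k) free_complex) (Suc i). \<Sum>t\<in>-B.
            (if subset_enum (Suc i) k = insert t B then ksign t B * var t else 0) * v k)"
      unfolding l(2) by_subsets_enum[OF l(1)]
      by (simp add: boundary_def l(1)) (simp add: koszul_complex_def sum_distrib_right)
    also have "\<dots> = (\<Sum>t\<in>-B. \<Sum>k<rank (koszul_complex :: ('n, 'k) free_complex) (Suc i).
            (if subset_enum (Suc i) k = insert t B then ksign t B * var t else 0) * v k)"
      by (rule sum.swap)
    also have "\<dots> = koszul_boundary (by_subsets (Suc i) v) B"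
      unfolding koszul_boundary_def by_subsets_def sum_distrib_left
      by (intro sum.cong refl) (auto simp: mult.assoc)
    finally show ?thesis by simp
  next
    case False
    then have "by_subsets (Suc i) v (insert t B) = 0" if "t \<notin> B" for t
      using that by (intro by_subsets_outside) simp
    then show ?thesis using False by (simp add: koszul_boundary_def by_subsets_outside)
  qed
qed

section \<open>Exactness of the Koszul complex and Betti numbers of monomial ideals\<close>

lemma koszul_boundary_boundary:
  "koszul_boundary (koszul_boundary c) = 0"
proof (rule slice_eqI)
  fix a show "slice (koszul_boundary (koszul_boundary c)) a = slice 0 a"
    by (simp add: slice_koszul_boundary simplicial_boundary_boundary) (simp add: slice_def fun_eq_iff)
qed

lemma lookup_le_imp_add:
  assumes "\<And>t. Poly_Mapping.lookup a t \<le> Poly_Mapping.lookup m t"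
  shows "\<exists>c. m = a + (c :: 'n \<Rightarrow>\<^sub>0 nat)"
  using assms by (intro exI[of _ "m - a"] poly_mapping_eqI) (simp add: lookup_add lookup_minus)

text \<open>If \<open>t\<close> is not in the face \<open>B\<close>, the quotient \<open>m\<close>
  has the same exponent at \<open>t\<close> as \<open>a\<close>. The assumption then splits off one
  more factor \<open>t\<close> without leaving \<open>U\<close>, so \<open>t\<close> can be joined
  to \<open>B\<close> and the complex is a cone.\<close>

lemma exponent_complex_apex:
  assumes U: "\<And>m c. m \<in> U \<Longrightarrow> m + c \<in> U"
    and t: "\<And>m. m \<in> U \<Longrightarrow> Poly_Mapping.lookup m t = Poly_Mapping.lookup a t \<Longrightarrow> \<exists>m'\<in>U. m = Poly_Mapping.single t 1 + m'"
  shows "insert t B \<in> exponent_complex U a \<longleftrightarrow> B \<in> exponent_complex U a"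
proof (cases "t \<in> B")
  case False
  have "B \<in> exponent_complex U a" if "insert t B \<in> exponent_complex U a"
    using that U by (auto simp: exponent_complex_def ind_insert[OF False] simp flip: add.assoc)
  moreover have "insert t B \<in> exponent_complex U a" if B: "B \<in> exponent_complex U a"
  proof -
    obtain m where m: "m \<in> U" "a = m + ind B" using B by (auto simp: exponent_complex_def)
    then obtain m' where "m' \<in> U" "m = Poly_Mapping.single t 1 + m'"
      using t[of m] False by (auto simp: lookup_add lookup_ind)
    then show ?thesis using m(2) by (auto simp: exponent_complex_def ind_insert[OF False] ac_simps)
  qed
  ultimately show ?thesis by blast
qed (simp add: insert_absorb)

text \<open>For the whole ring every variable dividing the multidegree is an apex. Only multidegree
  0 is left, where the empty set is the sole face; this is the residue field in index 0, excluded by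
  the condition on the constant coefficient.\<close>

lemma koszul_exact_UNIV:
  fixes c :: "'n::{finite,linorder} set \<Rightarrow> ('n, 'k::comm_ring_1) mpoly"
  assumes c: "c \<in> koszul_chains UNIV i" "koszul_boundary c = 0" "i = 0 \<Longrightarrow> coeff (c {}) 0 = 0"
  shows "\<exists>d \<in> koszul_chains UNIV (Suc i). koszul_boundary d = c"
proof -
  have "\<not> essential_cycle (exponent_complex UNIV a) i (slice c a)" if nz: "slice c a \<noteq> 0" for a
  proof (cases "a = 0")
    case True
    obtain B where "slice c 0 B \<noteq> 0" using nz True by (auto simp: fun_eq_iff)
    then obtain m where m: "0 = m + ind B" "coeff (c B) m \<noteq> 0"
      using slice_outside slice_add by metis
    from m(1) have "m = 0" "ind B = 0" using add_eq_0_poly_mapping_nat[of m "ind B"] by auto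
    moreover from this have "t \<notin> B" for t using lookup_ind[of B t] by auto
    then have "B = {}" by blast
    ultimately have nz0: "coeff (c {}) 0 \<noteq> 0" using m(2) by simp
    have "i = 0"
    proof (rule ccontr)
      assume "i \<noteq> 0"
      then have "c {} = 0" using c(1) by (simp add: koszul_chains_def)
      then show False using nz0 by simp
    qed
    then show ?thesis using c(3) nz0 by simp
  next
    case False
    then obtain t where t: "Poly_Mapping.lookup a t \<noteq> 0" by (auto simp: poly_mapping_eq_iff fun_eq_iff)
    show ?thesis
    proof (rule cone_no_essential_cycle[OF exponent_complex_apex])
      fix m assume "Poly_Mapping.lookup m t = Poly_Mapping.lookup a t"
      then have "\<exists>m'. m = Poly_Mapping.single t 1 + m'"
        using t by (intro lookup_le_imp_add) (auto simp: lookup_single when_def)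
      then show "\<exists>m'\<in>UNIV. m = Poly_Mapping.single t 1 + m'" by blast
    qed simp
  qed
  then show ?thesis using koszul_exact[OF c(1,2)] by blast
qed

lemma supported_on_UNIV [simp]: "supported_on UNIV = UNIV"
  by (simp add: supported_on_def)

lemma ksign_cases: "ksign t B = 1 \<or> ksign t B = -1"
  by (cases "even (card {s \<in> B. s < t})") (simp_all add: ksign_def)

lemma total_degree_single [simp]: "total_degree (Poly_Mapping.single t n) = n"
  by (simp add: total_degree_def lookup_single when_def)

lemma var_homogeneous: "var t \<in> homogeneous_part 1"
  by (simp add: homogeneous_part_def var_def)

theorem koszul_resolution:
  "graded_free_resolution (koszul_complex :: ('n::{finite,linorder}, 'k::field) free_complex)"
proof -
  let ?K = "koszul_complex :: ('n, 'k) free_complex"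
  have rank0: "rank ?K 0 = 1"
  proof -
    have "{B :: 'n set. card B = 0} = {{}}" by auto
    then show ?thesis by (simp only: rank_koszul) simp
  qed
  have enum0: "subset_enum 0 0 = ({} :: 'n set)"
    using card_subset_enum[of 0 0, where ?'n='n and ?'k='k] rank0 by auto
  have augment: "augment ?K v = coeff (by_subsets 0 v {}) 0" for v
  proof -
    have "augment ?K v = coeff (v 0) 0" unfolding augment_def rank0 by (simp add: koszul_complex_def)
    also have "v 0 = by_subsets 0 v {}"
      using by_subsets_enum[of 0 0 v] rank0 enum0 by simp
    finally show ?thesis .
  qed
  have chainsI: "boundary ?K i v \<in> chains ?K UNIV i" for i v
    by (simp add: chains_def boundary_def)
  \<comment> \<open>The entries of a Koszul boundary lie in the ideal of the variables, so the
    augmentation kills them.\<close>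
  have bd0: "coeff (koszul_boundary c B) 0 = 0" for c :: "'n set \<Rightarrow> ('n, 'k) mpoly" and B
  proof -
    have "coeff (var t :: ('n, 'k) mpoly) 0 = 0" for t :: 'n
      by (auto simp: var_def lookup_single when_def poly_mapping_eq_iff fun_eq_iff)
    then show ?thesis by (simp add: koszul_boundary_def lookup_sum coeff_mult_0)
  qed
  have low: "by_subsets (Suc i) v {} = (0 :: ('n, 'k) mpoly)" for i v by (rule by_subsets_outside) simp
  \<comment> \<open>One argument for cycles being boundaries at all indices; the condition
    \<open>z\<close> speaks about index 0 only.\<close>
  have img: "v \<in> boundary ?K i ` chains ?K UNIV (Suc i)"
    if v: "v \<in> chains ?K UNIV i" and bd: "koszul_boundary (by_subsets i v) = 0"
      and z: "i = 0 \<Longrightarrow> coeff (by_subsets i v {}) 0 = 0" for i v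
  proof -
    have "by_subsets i v \<in> koszul_chains UNIV i" using by_subsets_chains_iff[OF v, of UNIV] v by simp
    then obtain d where d: "d \<in> koszul_chains UNIV (Suc i)" "koszul_boundary d = by_subsets i v"
      using koszul_exact_UNIV[OF _ bd z] by blast
    then obtain w where w: "w \<in> chains ?K UNIV (Suc i)" "by_subsets (Suc i) w = d"
      using by_subsets_surj by blast
    then have "by_subsets i (boundary ?K i w) = by_subsets i v"
      using d(2) by (simp flip: koszul_boundary_by_subsets)
    then have "boundary ?K i w = v" using by_subsets_inject[OF chainsI v] by blast
    then show ?thesis using w(1) by blast
  qed
  have zero: "by_subsets i (0 :: nat \<Rightarrow> ('n, 'k) mpoly) = 0" for i
    by (simp add: by_subsets_def fun_eq_iff cong: if_cong)
  have "differential ?K i l k \<in> homogeneous_part (gen_degree ?K (Suc i) k - gen_degree ?K i l)" for i l k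
  proof -
    have "ksign t B * var t \<in> (homogeneous_part 1 :: ('n, 'k) mpoly set)" for t :: 'n and B
    proof -
      have "ksign t B = (1 :: ('n, 'k) mpoly) \<or> ksign t B = (-1 :: ('n, 'k) mpoly)" by (rule ksign_cases)
      then show ?thesis using var_homogeneous[of t] homogeneous_part_uminus by auto
    qed
    then have "(\<Sum>t\<in>- subset_enum i l. if subset_enum (Suc i) k = insert t (subset_enum i l)
        then ksign t (subset_enum i l) * var t else 0) \<in> (homogeneous_part 1 :: ('n, 'k) mpoly set)"
      by (intro homogeneous_part_sum) auto
    then show ?thesis by (simp add: koszul_complex_def)
  qed
  moreover have "augment ?K ` chains ?K UNIV 0 = UNIV"
  proof (intro equalityI subset_UNIV subsetI)
    fix x :: 'k
    have "(\<lambda>k. if k < rank ?K 0 then Poly_Mapping.single 0 x else 0) \<in> chains ?K UNIV 0"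
      by (simp add: chains_def)
    moreover have "augment ?K (\<lambda>k. if k < rank ?K 0 then Poly_Mapping.single 0 x else 0) = x"
      unfolding augment_def rank0 by (simp add: koszul_complex_def)
    ultimately show "x \<in> augment ?K ` chains ?K UNIV 0" by (metis imageI)
  qed
  moreover have "{v \<in> chains ?K UNIV 0. augment ?K v = 0} = boundary ?K 0 ` chains ?K UNIV 1"
  proof (intro equalityI subsetI)
    fix v assume v: "v \<in> {v \<in> chains ?K UNIV 0. augment ?K v = 0}"
    have "koszul_boundary (by_subsets 0 v) = 0"
      by (auto simp: koszul_boundary_def fun_eq_iff by_subsets_outside intro!: sum.neutral)
    then show "v \<in> boundary ?K 0 ` chains ?K UNIV 1" using img[of v 0] v augment[of v] by simp
  next
    fix v assume "v \<in> boundary ?K 0 ` chains ?K UNIV 1"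
    then obtain w where w: "v = boundary ?K 0 w" by blast
    then show "v \<in> {v \<in> chains ?K UNIV 0. augment ?K v = 0}"
      using chainsI by (simp add: augment bd0 flip: koszul_boundary_by_subsets)
  qed
  moreover have "{v \<in> chains ?K UNIV (Suc i). boundary ?K i v = 0} = boundary ?K (Suc i) ` chains ?K UNIV (Suc (Suc i))" for i
  proof (intro equalityI subsetI)
    fix v assume v: "v \<in> {v \<in> chains ?K UNIV (Suc i). boundary ?K i v = 0}"
    then have "koszul_boundary (by_subsets (Suc i) v) = 0"
      by (simp add: koszul_boundary_by_subsets zero)
    then show "v \<in> boundary ?K (Suc i) ` chains ?K UNIV (Suc (Suc i))" using img[of v "Suc i"] v by simp
  next
    fix v assume "v \<in> boundary ?K (Suc i) ` chains ?K UNIV (Suc (Suc i))"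
    then obtain w where w: "v = boundary ?K (Suc i) w" by blast
    have "by_subsets i (boundary ?K i v) = by_subsets i 0"
      by (simp add: w koszul_boundary_boundary zero flip: koszul_boundary_by_subsets)
    then have "boundary ?K i v = 0"
      by (rule by_subsets_inject[OF chainsI, rotated]) (simp add: chains_def)
    then show "v \<in> {v \<in> chains ?K UNIV (Suc i). boundary ?K i v = 0}" using w chainsI by simp
  qed
  ultimately show ?thesis unfolding graded_free_resolution_def by simp
qed

text \<open>Independence from the resolution allows the Koszul complex here. The dictionary
  \<open>by_subsets\<close> and the splitting into slices then give a Hochster-type formula in the
  form of a criterion for non-vanishing.\<close>

theorem betti_supported_on:
  fixes U :: "('n::{finite,linorder} \<Rightarrow>\<^sub>0 nat) set"
  assumes M: "ring_module.subspace (supported_on U :: ('n, 'k::field) mpoly set)"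
  shows "graded_betti (supported_on U :: ('n, 'k) mpoly set) i j \<noteq> 0 \<longleftrightarrow>
    (\<exists>a (z :: 'n set \<Rightarrow> 'k). int (total_degree a) = j \<and> essential_cycle (exponent_complex U a) i z)"
proof -
  let ?K = "koszul_complex :: ('n, 'k) free_complex" and ?M = "supported_on U :: ('n, 'k) mpoly set"
  have sub: "graded_chains ?K ?M i' j \<subseteq> chains ?K UNIV i'" for i'
    by (auto simp: graded_chains_def chains_def)
  have sub': "graded_koszul_chains U i' j \<subseteq> (koszul_chains UNIV i' :: ('n set \<Rightarrow> ('n, 'k) mpoly) set)" for i'
    by (auto simp: graded_koszul_chains_def koszul_chains_def)
  \<comment> \<open>At index 0 both sides are true: a Koszul boundary looks only at nonempty sets,
    where \<open>by_subsets 0 v\<close> is 0.\<close>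
  have bdz: "(case i of 0 \<Rightarrow> True | Suc i' \<Rightarrow> boundary ?K i' v = 0) \<longleftrightarrow> koszul_boundary (by_subsets i v) = 0"
    if v: "v \<in> chains ?K UNIV i" for v
  proof (cases i)
    case 0
    then show ?thesis
      by (auto simp: koszul_boundary_def fun_eq_iff by_subsets_outside intro!: sum.neutral)
  next
    case (Suc i')
    have zero: "by_subsets i' (0 :: nat \<Rightarrow> ('n, 'k) mpoly) = 0"
      by (simp add: by_subsets_def fun_eq_iff cong: if_cong)
    have "boundary ?K i' v = 0 \<longleftrightarrow> by_subsets i' (boundary ?K i' v) = by_subsets i' 0"
      using by_subsets_inject[of "boundary ?K i' v" i' 0] by (auto simp: chains_def boundary_def)
    then show ?thesis by (simp add: Suc koszul_boundary_by_subsets zero)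
  qed
  have bdi: "v \<in> tor_boundaries ?K ?M i j \<longleftrightarrow> by_subsets i v \<in> koszul_boundary ` graded_koszul_chains U (Suc i) j"
    if v: "v \<in> chains ?K UNIV i" for v
  proof
    assume "v \<in> tor_boundaries ?K ?M i j"
    then obtain w where w: "w \<in> graded_chains ?K ?M (Suc i) j" "v = boundary ?K i w"
      by (auto simp: tor_boundaries_def)
    then have "by_subsets (Suc i) w \<in> graded_koszul_chains U (Suc i) j"
      using by_subsets_graded_iff[of w "Suc i" U j] sub by blast
    then show "by_subsets i v \<in> koszul_boundary ` graded_koszul_chains U (Suc i) j"
      by (simp add: w(2) flip: koszul_boundary_by_subsets)
  next
    assume "by_subsets i v \<in> koszul_boundary ` graded_koszul_chains U (Suc i) j"
    then obtain d where d: "d \<in> graded_koszul_chains U (Suc i) j" "by_subsets i v = koszul_boundary d" by blast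
    then obtain w where w: "w \<in> chains ?K UNIV (Suc i)" "by_subsets (Suc i) w = d"
      using by_subsets_surj[of d "Suc i"] sub' by blast
    then have "w \<in> graded_chains ?K ?M (Suc i) j" using by_subsets_graded_iff[OF w(1)] d(1) by blast
    moreover have "by_subsets i (boundary ?K i w) = by_subsets i v"
      using w(2) d(2) by (simp flip: koszul_boundary_by_subsets)
    then have "boundary ?K i w = v"
      by (rule by_subsets_inject[OF _ v, rotated]) (simp add: chains_def boundary_def)
    ultimately show "v \<in> tor_boundaries ?K ?M i j" unfolding tor_boundaries_def by (metis imageI)
  qed
  have "\<not> tor_cycles ?K ?M i j \<subseteq> tor_boundaries ?K ?M i j \<longleftrightarrow>
    (\<exists>v. v \<in> graded_chains ?K ?M i j \<and> koszul_boundary (by_subsets i v) = 0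
      \<and> by_subsets i v \<notin> koszul_boundary ` graded_koszul_chains U (Suc i) j)"
    using bdz bdi sub[of i] unfolding tor_cycles_def by blast
  also have "\<dots> \<longleftrightarrow> (\<exists>c :: 'n set \<Rightarrow> ('n, 'k) mpoly. c \<in> graded_koszul_chains U i j \<and> koszul_boundary c = 0
      \<and> c \<notin> koszul_boundary ` graded_koszul_chains U (Suc i) j)"
  proof
    assume "\<exists>v. v \<in> graded_chains ?K ?M i j \<and> koszul_boundary (by_subsets i v) = 0
      \<and> by_subsets i v \<notin> koszul_boundary ` graded_koszul_chains U (Suc i) j"
    then show "\<exists>c :: 'n set \<Rightarrow> ('n, 'k) mpoly. c \<in> graded_koszul_chains U i j \<and> koszul_boundary c = 0
      \<and> c \<notin> koszul_boundary ` graded_koszul_chains U (Suc i) j"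
      using by_subsets_graded_iff[of _ i U j] sub by blast
  next
    assume "\<exists>c :: 'n set \<Rightarrow> ('n, 'k) mpoly. c \<in> graded_koszul_chains U i j \<and> koszul_boundary c = 0
      \<and> c \<notin> koszul_boundary ` graded_koszul_chains U (Suc i) j"
    then obtain c :: "'n set \<Rightarrow> ('n, 'k) mpoly" where c: "c \<in> graded_koszul_chains U i j" "koszul_boundary c = 0"
      "c \<notin> koszul_boundary ` graded_koszul_chains U (Suc i) j" by blast
    then obtain v where v: "v \<in> chains ?K UNIV i" "by_subsets i v = c"
      using by_subsets_surj[of c i] sub' by blast
    then have "v \<in> graded_chains ?K ?M i j" using by_subsets_graded_iff[OF v(1), of U j] c(1) by simp
    then show "\<exists>v. v \<in> graded_chains ?K ?M i j \<and> koszul_boundary (by_subsets i v) = 0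
      \<and> by_subsets i v \<notin> koszul_boundary ` graded_koszul_chains U (Suc i) j"
      using v c by blast
  qed
  finally show ?thesis
    unfolding graded_betti_nonzero_iff[OF koszul_resolution M] koszul_homology_multigraded .
qed

section \<open>Monomial ideals and bracket powers\<close>

lemma supported_on_subspace:
  assumes U: "\<And>m c. m \<in> U \<Longrightarrow> m + c \<in> U"
  shows "ring_module.subspace (supported_on U :: ('n, 'k::comm_ring_1) mpoly set)"
proof (rule ring_module.subspaceI)
  show "0 \<in> supported_on U" by (simp add: supported_on_def)
  show "f + g \<in> supported_on U" if "f \<in> supported_on U" "g \<in> supported_on U" for f g :: "('n, 'k) mpoly"
    using that keys_add[of f g] by (auto simp: supported_on_def)
  show "g * f \<in> supported_on U" if "f \<in> supported_on U" for f g :: "('n, 'k) mpoly"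
  proof -
    have "Poly_Mapping.keys (g * f) \<subseteq> {a + b |a b. a \<in> Poly_Mapping.keys g \<and> b \<in> Poly_Mapping.keys f}"
      by (rule keys_mult)
    also have "\<dots> \<subseteq> U"
      using that U by (auto simp: supported_on_def) (metis U add.commute subsetD)
    finally show ?thesis by (simp add: supported_on_def)
  qed
qed

text \<open>A polynomial is the sum of its terms, and a term whose exponent is \<open>a + c\<close>
  is a multiple of the generator with exponent \<open>a\<close>.\<close>

lemma span_monomials:
  "ring_module.span ((\<lambda>a. Poly_Mapping.single a 1) ` A) = (supported_on {a + c | a c. a \<in> A} :: ('n, 'k::comm_ring_1) mpoly set)"
  (is "ring_module.span ?B = ?M")
proof (intro equalityI)
  have "ring_module.subspace ?M"
    by (rule supported_on_subspace) (auto simp: add.assoc, blast)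
  moreover have "a \<in> {a + c | a c. a \<in> A}" if "a \<in> A" for a
    using that by (intro CollectI exI[of _ a] exI[of _ 0]) simp
  ultimately show "ring_module.span ?B \<subseteq> ?M"
    by (intro ring_module.span_minimal) (auto simp: supported_on_def)
  show "?M \<subseteq> ring_module.span ?B"
  proof
    fix f assume f: "f \<in> ?M"
    have "Poly_Mapping.single m x \<in> ring_module.span ?B" if "m \<in> Poly_Mapping.keys f" for m x
    proof -
      have "m \<in> {a + c | a c. a \<in> A}" using f that by (auto simp only: supported_on_def mem_Collect_eq subset_iff)
      then obtain a c where "m = a + c" "a \<in> A" by blast
      then have "Poly_Mapping.single m x = Poly_Mapping.single c x * Poly_Mapping.single a 1"
        by (simp add: mult_single add.commute)
      moreover have "Poly_Mapping.single a 1 \<in> ring_module.span ?B"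
        using \<open>a \<in> A\<close> by (intro ring_module.span_base) blast
      ultimately show ?thesis by (simp only: ring_module.span_scale)
    qed
    then have "(\<Sum>m\<in>Poly_Mapping.keys f. Poly_Mapping.single m (coeff f m)) \<in> ring_module.span ?B"
      by (rule ring_module.span_sum)
    then show "f \<in> ring_module.span ?B" by (simp add: sum_monomials)
  qed
qed

lemma monomial_ideal_supported_on:
  fixes I :: "('n, 'k::comm_ring_1) mpoly set"
  assumes "monomial_ideal I"
  obtains U where "\<And>m c. m \<in> U \<Longrightarrow> m + c \<in> U" "I = supported_on U"
proof -
  obtain V where V: "\<And>u. u \<in> V \<Longrightarrow> is_monomial u" "I = ring_module.span V"
    using assms by (auto simp: monomial_ideal_def)
  define A where "A = {a. Poly_Mapping.single a 1 \<in> V}"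
  have "V = (\<lambda>a. Poly_Mapping.single a 1) ` A"
    using V(1) by (auto simp: A_def is_monomial_def image_iff)
  then have "I = supported_on {a + c | a c. a \<in> A}"
    using V(2) by (simp add: span_monomials)
  then show ?thesis by (rule that[rotated]) (auto simp: add.assoc, blast)
qed

section \<open>Bracket powers on the level of exponents\<close>

definition nat_scale :: "nat \<Rightarrow> ('n \<Rightarrow>\<^sub>0 nat) \<Rightarrow> 'n \<Rightarrow>\<^sub>0 nat"
  where "nat_scale q = Poly_Mapping.map ((*) q)"

lemma lookup_nat_scale [simp]: "Poly_Mapping.lookup (nat_scale q a) t = q * Poly_Mapping.lookup a t"
  by (simp add: nat_scale_def Poly_Mapping.map.rep_eq when_def)

lemma monomial_power: "Poly_Mapping.single a (1 :: 'k::comm_ring_1) ^ q = Poly_Mapping.single (nat_scale q a) 1"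
proof (induct q)
  case 0
  have "nat_scale 0 a = 0" by (rule poly_mapping_eqI) simp
  then show ?case by simp
next
  case (Suc q)
  have "nat_scale (Suc q) a = a + nat_scale q a" by (rule poly_mapping_eqI) (simp add: lookup_add)
  then show ?case by (simp add: Suc mult_single)
qed

text \<open>\<open>U\<close> is meant to hold the exponents of all monomials of the ideal, as in
  \<open>bracket_power\<close>; the summand \<open>c\<close> closes the scaled set under
  multiplication.\<close>

definition frobenius_exponents :: "nat \<Rightarrow> ('n \<Rightarrow>\<^sub>0 nat) set \<Rightarrow> ('n \<Rightarrow>\<^sub>0 nat) set"
  where "frobenius_exponents q U = {nat_scale q u + c | u c. u \<in> U}"

lemma bracket_power_supported_on:
  "bracket_power (supported_on U :: ('n, 'k::comm_ring_1) mpoly set) q = supported_on (frobenius_exponents q U)"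
proof -
  have "{u ^ q | u. u \<in> (supported_on U :: ('n, 'k) mpoly set) \<and> is_monomial u}
      = (\<lambda>a. Poly_Mapping.single a 1) ` nat_scale q ` U"
    by (auto simp: supported_on_def is_monomial_def monomial_power image_iff) (force simp flip: monomial_power)+
  then show ?thesis
    unfolding bracket_power_def
    by (simp only: span_monomials) (auto simp: frobenius_exponents_def intro!: arg_cong[of _ _ supported_on])
qed

lemma total_degree_nat_scale: "total_degree (nat_scale q a) = q * total_degree a"
  by (simp add: total_degree_def sum_distrib_left)

lemma frobenius_exponents_upclosed: "m \<in> frobenius_exponents q U \<Longrightarrow> m + c \<in> frobenius_exponents q U"
  by (auto simp: frobenius_exponents_def add.assoc) blast

text \<open>If \<open>q\<close> does not divide the exponent at \<open>t\<close>, a monomial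
  \<open>nat_scale q u + c\<close> with that exponent has a positive exponent of \<open>t\<close> in
  \<open>c\<close>. A factor \<open>t\<close> can be taken from \<open>c\<close>, which leaves the
  monomial in the bracket power, so \<open>t\<close> is an apex.\<close>

lemma essential_cycle_frobenius_dvd:
  assumes ess: "essential_cycle (exponent_complex (frobenius_exponents q U) a) i z" and q: "q > 0"
  shows "\<exists>a'. a = nat_scale q a'"
proof -
  have dvd: "q dvd Poly_Mapping.lookup a t" for t
  proof (rule ccontr)
    assume nd: "\<not> q dvd Poly_Mapping.lookup a t"
    have "insert t B \<in> exponent_complex (frobenius_exponents q U) a \<longleftrightarrow> B \<in> exponent_complex (frobenius_exponents q U) a" for B
    proof (rule exponent_complex_apex[OF frobenius_exponents_upclosed])
      fix m assume "m \<in> frobenius_exponents q U" and mt: "Poly_Mapping.lookup m t = Poly_Mapping.lookup a t"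
      then obtain u c where u: "u \<in> U" "m = nat_scale q u + c" by (auto simp: frobenius_exponents_def)
      then have "Poly_Mapping.lookup c t \<noteq> 0"
        using mt nd by (metis add_0_right dvd_triv_left lookup_add lookup_nat_scale)
      then have "\<exists>c'. c = Poly_Mapping.single t 1 + c'"
        by (intro lookup_le_imp_add) (auto simp: lookup_single when_def)
      then obtain c' where "c = Poly_Mapping.single t 1 + c'" ..
      then have "m = Poly_Mapping.single t 1 + (nat_scale q u + c')" by (simp add: u ac_simps)
      then show "\<exists>m'\<in>frobenius_exponents q U. m = Poly_Mapping.single t 1 + m'"
        using u(1) by (auto simp: frobenius_exponents_def)
    qed
    then show False using ess cone_no_essential_cycle by blast
  qed
  define a' where "a' = Poly_Mapping.map (\<lambda>x. x div q) a"
  have "a = nat_scale q a'"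
    using dvd by (intro poly_mapping_eqI) (simp add: a'_def Poly_Mapping.map.rep_eq when_def)
  then show ?thesis ..
qed

text \<open>In a coordinate of \<open>B\<close>, exceeding \<open>q\<close> times the exponent of
  \<open>u\<close> by 1 already forces a multiple of \<open>q\<close> to be at least
  \<open>q\<close> times that exponent plus 1. So a face for the bracket power is a face for
  \<open>U\<close>.\<close>

lemma exponent_complex_frobenius:
  assumes U: "\<And>m c. m \<in> U \<Longrightarrow> m + c \<in> U" and q: "q > 0"
  shows "exponent_complex (frobenius_exponents q U) (nat_scale q a) = exponent_complex U a"
proof (intro equalityI subsetI)
  fix B assume "B \<in> exponent_complex (frobenius_exponents q U) (nat_scale q a)"
  then obtain u c where u: "u \<in> U" "nat_scale q a = nat_scale q u + c + ind B"
    by (auto simp: exponent_complex_def frobenius_exponents_def)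
  have "\<exists>c'. a = (u + ind B) + c'"
  proof (rule lookup_le_imp_add)
    fix t
    have "q * Poly_Mapping.lookup a t = q * Poly_Mapping.lookup u t + Poly_Mapping.lookup c t + Poly_Mapping.lookup (ind B) t"
      using arg_cong[OF u(2), of "\<lambda>f. Poly_Mapping.lookup f t"] by (simp add: lookup_add)
    then have *: "q * Poly_Mapping.lookup a t \<ge> q * Poly_Mapping.lookup u t + Poly_Mapping.lookup (ind B) t" by simp
    show "Poly_Mapping.lookup (u + ind B) t \<le> Poly_Mapping.lookup a t"
    proof (cases "t \<in> B")
      case True
      then have "q * Poly_Mapping.lookup u t < q * Poly_Mapping.lookup a t"
        using * by (simp only: lookup_ind if_True)
      then have "Poly_Mapping.lookup u t < Poly_Mapping.lookup a t" by simp
      then show ?thesis using True by (simp add: lookup_add lookup_ind)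
    next
      case False
      then show ?thesis using * q by (simp add: lookup_add lookup_ind)
    qed
  qed
  then obtain c' where "a = (u + c') + ind B" by (auto simp: ac_simps)
  then show "B \<in> exponent_complex U a" using U[OF u(1)] by (auto simp: exponent_complex_def)
next
  fix B assume "B \<in> exponent_complex U a"
  then obtain m where m: "m \<in> U" "a = m + ind B" by (auto simp: exponent_complex_def)
  \<comment> \<open>Scaling \<open>m + ind B\<close> leaves \<open>q - 1\<close> further copies of
    \<open>ind B\<close>, which are absorbed by the free summand of
    \<open>frobenius_exponents\<close>.\<close>
  have "nat_scale q a = (nat_scale q m + nat_scale (q - 1) (ind B)) + ind B"
    using q by (intro poly_mapping_eqI) (simp add: m(2) lookup_add lookup_ind algebra_simps)
  then show "B \<in> exponent_complex (frobenius_exponents q U) (nat_scale q a)"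
    using m(1) by (auto simp: exponent_complex_def frobenius_exponents_def)
qed

section \<open>Finiteness of the essential multidegrees\<close>

text \<open>One variable at a time: every sequence has a monotone subsequence, and a decreasing
  sequence of naturals is constant from the point where it attains its minimum.\<close>

lemma exponents_monotone_subsequence:
  fixes f :: "nat \<Rightarrow> 'n::finite \<Rightarrow>\<^sub>0 nat"
  shows "\<exists>r. strict_mono r \<and> (\<forall>t. incseq (\<lambda>k. Poly_Mapping.lookup (f (r k)) t))"
proof -
  have "\<exists>r. strict_mono r \<and> (\<forall>t\<in>T. incseq (\<lambda>k. Poly_Mapping.lookup (f (r k)) t))" if "finite T" for T :: "'n set"
    using that
  proof (induct T)
    case empty
    show ?case by (intro exI[of _ id]) (simp add: strict_mono_def)
  next
    case (insert t T)
    then obtain r where r: "strict_mono r" "\<And>t. t \<in> T \<Longrightarrow> incseq (\<lambda>k. Poly_Mapping.lookup (f (r k)) t)" by blast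
    define g where "g k = Poly_Mapping.lookup (f (r k)) t" for k
    obtain s where s: "strict_mono s" "monoseq (\<lambda>k. g (s k))" using seq_monosub by blast
    have "\<exists>s. strict_mono (s :: nat \<Rightarrow> nat) \<and> incseq (\<lambda>k. g (s k))"
    proof (cases "incseq (\<lambda>k. g (s k))")
      case False
      then have dec: "decseq (\<lambda>k. g (s k))" using s(2) monoseq_iff by blast
      define v where "v = (LEAST v. \<exists>k. g (s k) = v)"
      obtain k0 where k0: "g (s k0) = v"
        unfolding v_def using LeastI[of "\<lambda>v. \<exists>k. g (s k) = v" "g (s 0)"] by blast
      have "g (s (k + k0)) = v" for k
      proof (rule antisym)
        show "g (s (k + k0)) \<le> v" using dec k0 by (auto simp: decseq_def)
        show "v \<le> g (s (k + k0))" unfolding v_def by (rule Least_le) blast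
      qed
      then have "incseq (\<lambda>k. g (s (k + k0)))" by (simp add: incseq_def)
      moreover have "strict_mono (\<lambda>k. s (k + k0))" using s(1) by (auto simp: strict_mono_def)
      ultimately show ?thesis by blast
    qed (use s in blast)
    then obtain s where s: "strict_mono (s :: nat \<Rightarrow> nat)" "incseq (\<lambda>k. g (s k))" by blast
    have "strict_mono (\<lambda>k. r (s k))" using r(1) s(1) by (auto simp: strict_mono_def)
    moreover have "incseq (\<lambda>k. Poly_Mapping.lookup (f (r (s k))) t')" if "t' \<in> insert t T" for t'
    proof (cases "t' = t")
      case True
      then show ?thesis using s(2) by (simp add: g_def)
    next
      case False
      then have "incseq (\<lambda>k. Poly_Mapping.lookup (f (r k)) t')" using r(2) that by blast
      then show ?thesis using strict_mono_mono[OF s(1)] by (auto simp: incseq_def mono_def)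
    qed
    ultimately show ?case by blast
  qed
  from this[of UNIV] show ?thesis by simp
qed

text \<open>The elements minimal under divisibility generate. If there were infinitely many, a
  subsequence increasing in all coordinates would contain two comparable minimal elements, which
  would have to coincide.\<close>

lemma dickson:
  fixes U :: "('n::finite \<Rightarrow>\<^sub>0 nat) set"
  obtains G where "finite G" "G \<subseteq> U" "\<And>m. m \<in> U \<Longrightarrow> \<exists>g\<in>G. \<exists>c. m = g + c"
proof
  define G where "G = {g \<in> U. \<forall>h\<in>U. (\<exists>c. g = h + c) \<longrightarrow> h = g}"
  show "G \<subseteq> U" by (auto simp: G_def)
  show "\<exists>g\<in>G. \<exists>c. m = g + c" if "m \<in> U" for m
    using that
  proof (induct "total_degree m" arbitrary: m rule: less_induct)
    case less
    show ?case
    proof (cases "m \<in> G")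
      case True
      then show ?thesis by (metis add_0_right)
    next
      case False
      then obtain h c where h: "h \<in> U" "m = h + c" "h \<noteq> m" using less.prems by (auto simp: G_def)
      then have "c \<noteq> 0" by auto
      then obtain t where "Poly_Mapping.lookup c t \<noteq> 0" by (auto simp: poly_mapping_eq_iff fun_eq_iff)
      then have "total_degree h < total_degree m"
        using lookup_le_total_degree[of c t] by (simp add: h(2) total_degree_add)
      then obtain g c' where "g \<in> G" "h = g + c'" using less.hyps h(1) by blast
      then show ?thesis using h(2) by (auto simp: add.assoc)
    qed
  qed
  show "finite G"
  proof (rule ccontr)
    assume "infinite G"
    then obtain f :: "nat \<Rightarrow> 'n \<Rightarrow>\<^sub>0 nat" where f: "inj f" "\<And>k. f k \<in> G"
      using infinite_countable_subset by (metis rangeI subsetD)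
    obtain r where r: "strict_mono r" "\<And>t. incseq (\<lambda>k. Poly_Mapping.lookup (f (r k)) t)"
      using exponents_monotone_subsequence by blast
    have "\<exists>c. f (r 1) = f (r 0) + c"
      by (rule lookup_le_imp_add) (use r(2) in \<open>auto simp: incseq_def\<close>)
    then have "f (r 0) = f (r 1)" using f(2) unfolding G_def by blast
    then have "r 0 = r 1" using f(1) by (auto dest: injD)
    then show False using strict_monoD[OF r(1), of 0 1] by simp
  qed
qed

text \<open>If \<open>a\<close> exceeds all generators at \<open>t\<close>, every multiple of a
  generator with that exponent has a factor \<open>t\<close> to spare, so the complex is a cone. The
  essential multidegrees thus lie in a box.\<close>

lemma finite_essential_degrees:
  assumes U: "\<And>m c. m \<in> U \<Longrightarrow> m + c \<in> (U :: ('n::{finite,linorder} \<Rightarrow>\<^sub>0 nat) set)"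
  shows "finite {a. \<exists>i (z :: 'n set \<Rightarrow> 'k::comm_ring_1). essential_cycle (exponent_complex U a) i z}"
proof -
  obtain G where G: "finite G" "G \<subseteq> U" "\<And>m. m \<in> U \<Longrightarrow> \<exists>g\<in>G. \<exists>c. m = g + c"
    using dickson[of U] by blast
  \<comment> \<open>A sum in place of a maximum: it still bounds every generator, and it makes sense
    for empty \<open>G\<close>.\<close>
  define d where "d t = (\<Sum>g\<in>G. Poly_Mapping.lookup g t)" for t
  have le: "Poly_Mapping.lookup g t \<le> d t" if "g \<in> G" for g t
    unfolding d_def using that by (intro member_le_sum G(1)) auto
  have "Poly_Mapping.lookup a t \<le> d t"
    if ess: "essential_cycle (exponent_complex U a) i (z :: 'n set \<Rightarrow> 'k)" for a i z t
  proof (rule ccontr)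
    assume gt: "\<not> Poly_Mapping.lookup a t \<le> d t"
    have "insert t B \<in> exponent_complex U a \<longleftrightarrow> B \<in> exponent_complex U a" for B
    proof (rule exponent_complex_apex[OF U])
      fix m assume m: "m \<in> U" "Poly_Mapping.lookup m t = Poly_Mapping.lookup a t"
      then obtain g c where g: "g \<in> G" "m = g + c" using G(3) by blast
      then have "Poly_Mapping.lookup c t \<noteq> 0"
        using le[OF g(1), of t] m(2) gt by (auto simp: lookup_add)
      then have "\<exists>c'. c = Poly_Mapping.single t 1 + c'"
        by (intro lookup_le_imp_add) (auto simp: lookup_single when_def)
      then obtain c' where "c = Poly_Mapping.single t 1 + c'" ..
      then have "m = Poly_Mapping.single t 1 + (g + c')" by (simp add: g ac_simps)
      then show "\<exists>m'\<in>U. m = Poly_Mapping.single t 1 + m'"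
        using U g(1) G(2) by blast
    qed
    then show False using ess cone_no_essential_cycle by blast
  qed
  then have "{a. \<exists>i (z :: 'n set \<Rightarrow> 'k). essential_cycle (exponent_complex U a) i z} \<subseteq> {a. \<forall>t. Poly_Mapping.lookup a t \<le> d t}"
    by blast
  then show ?thesis using finite_lookup_bounded by (rule finite_subset)
qed

section \<open>Regularity read off from essential cycles\<close>

text \<open>No variable can be divided out of a monomial of least total degree, so the empty set is
  the only face; the degree is positive because 1 is not in the ideal.\<close>

lemma essential_cycle_minimal_generator:
  assumes "U \<noteq> {}" "0 \<notin> U"
  shows "\<exists>a (z :: 'n::{finite,linorder} set \<Rightarrow> 'k::comm_ring_1). total_degree a \<ge> 1 \<and> essential_cycle (exponent_complex U a) 0 z"
proof -
  obtain a where a: "a \<in> U" "\<And>m. m \<in> U \<Longrightarrow> total_degree a \<le> total_degree m"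
    using assms(1) ex_has_least_nat[of "\<lambda>m. m \<in> U" _ total_degree] by blast
  have "a \<noteq> 0" using a(1) assms(2) by auto
  then obtain t where "Poly_Mapping.lookup a t \<noteq> 0" by (auto simp: poly_mapping_eq_iff fun_eq_iff)
  then have "total_degree a \<ge> 1" using lookup_le_total_degree[of a t] by simp
  moreover have "exponent_complex U a = {{}}"
  proof (intro equalityI subsetI)
    fix B assume "B \<in> exponent_complex U a"
    then obtain m where "m \<in> U" "a = m + ind B" by (auto simp: exponent_complex_def)
    then have "card B = 0" using a(2)[of m] by (simp add: total_degree_add total_degree_ind)
    then show "B \<in> {{}}" by simp
  next
    fix B :: "'n set" assume "B \<in> {{}}"
    then show "B \<in> exponent_complex U a" using a(1) by (simp add: exponent_complex_def)
  qed
  ultimately show ?thesis using essential_cycle_point by metis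
qed

text \<open>The set under \<open>Max\<close> is finite because multidegrees are confined by
  \<open>finite_essential_degrees\<close> and homological degrees by
  \<open>essential_cycle_degree\<close>. From here on regularity is accessed only through these two
  facts.\<close>

lemma
  fixes U :: "('n::{finite,linorder} \<Rightarrow>\<^sub>0 nat) set"
  assumes U: "\<And>m c. m \<in> U \<Longrightarrow> m + c \<in> U"
  shows regularity_ge:
      "\<And>a i (z :: 'n set \<Rightarrow> 'k::field). essential_cycle (exponent_complex U a) i z \<Longrightarrow>
        int (total_degree a) - int i \<le> regularity (supported_on U :: ('n, 'k) mpoly set)"
    and regularity_attained:
      "U \<noteq> {} \<Longrightarrow> 0 \<notin> U \<Longrightarrow> \<exists>a i (z :: 'n set \<Rightarrow> 'k). essential_cycle (exponent_complex U a) i z \<and>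
        regularity (supported_on U :: ('n, 'k) mpoly set) = int (total_degree a) - int i"
proof -
  let ?M = "supported_on U :: ('n, 'k) mpoly set"
  let ?S = "{j - int i | i j. graded_betti ?M i j \<noteq> 0}"
  let ?A = "{a. \<exists>i (z :: 'n set \<Rightarrow> 'k). essential_cycle (exponent_complex U a) i z}"
  have betti: "graded_betti ?M i j \<noteq> 0 \<longleftrightarrow>
      (\<exists>a (z :: 'n set \<Rightarrow> 'k). int (total_degree a) = j \<and> essential_cycle (exponent_complex U a) i z)" for i j
    by (rule betti_supported_on[OF supported_on_subspace[OF U]])
  have S: "?S = {int (total_degree a) - int i | a i. \<exists>z :: 'n set \<Rightarrow> 'k. essential_cycle (exponent_complex U a) i z}"
    unfolding betti by blast
  have "?S \<subseteq> (\<lambda>(a, i). int (total_degree a) - int i) ` (?A \<times> {..<CARD('n)})"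
    unfolding S using essential_cycle_degree by fastforce
  then have fin: "finite ?S"
    by (rule finite_subset) (intro finite_imageI finite_cartesian_product finite_essential_degrees[OF U], auto)
  show "int (total_degree a) - int i \<le> regularity ?M"
    if "essential_cycle (exponent_complex U a) i (z :: 'n set \<Rightarrow> 'k)" for a i z
    unfolding regularity_def by (rule Max_ge[OF fin], unfold S, use that in blast)
  assume "U \<noteq> {}" "0 \<notin> U"
  then have "?S \<noteq> {}"
    unfolding S using essential_cycle_minimal_generator[of U, where ?'k='k] by blast
  then have "regularity ?M \<in> ?S"
    unfolding regularity_def by (rule Max_in[OF fin])
  then show "\<exists>a i (z :: 'n set \<Rightarrow> 'k). essential_cycle (exponent_complex U a) i z \<and>
        regularity ?M = int (total_degree a) - int i"
    unfolding S by blast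
qed

theorem regularity_bracket_power:
  fixes U :: "('n::{finite,linorder} \<Rightarrow>\<^sub>0 nat) set" and q :: nat
  assumes U: "\<And>m c. m \<in> U \<Longrightarrow> m + c \<in> U" and ne: "U \<noteq> {}" "0 \<notin> U" and q: "q > 0"
  defines "I \<equiv> supported_on U :: ('n, 'k::field) mpoly set"
  shows "regularity I \<ge> 1"
    and "regularity (bracket_power I q) \<le> int q * regularity I + (int q - 1) * (int CARD('n) - 1)"
proof -
  obtain a and z :: "'n set \<Rightarrow> 'k" where a: "total_degree a \<ge> 1" "essential_cycle (exponent_complex U a) 0 z"
    using essential_cycle_minimal_generator[OF ne] by blast
  show "regularity I \<ge> 1" using regularity_ge[OF U a(2)] a(1) by (simp add: I_def)
  let ?V = "frobenius_exponents q U"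
  have "?V \<noteq> {}" using ne(1) by (auto simp: frobenius_exponents_def)
  moreover have "0 \<notin> ?V"
  proof
    assume "0 \<in> ?V"
    then obtain u c where u: "u \<in> U" "nat_scale q u + c = 0" by (force simp: frobenius_exponents_def)
    then have "nat_scale q u = 0" by (simp add: add_eq_0_poly_mapping_nat)
    then have "q * Poly_Mapping.lookup u t = 0" for t by (metis lookup_nat_scale lookup_zero)
    then have "u = 0" using q by (intro poly_mapping_eqI) auto
    then show False using u(1) ne(2) by simp
  qed
  ultimately obtain b i and y :: "'n set \<Rightarrow> 'k" where b: "essential_cycle (exponent_complex ?V b) i y"
    "regularity (supported_on ?V :: ('n, 'k) mpoly set) = int (total_degree b) - int i"
    using regularity_attained[of ?V, where ?'k='k] frobenius_exponents_upclosed by metis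
  obtain b' where b': "b = nat_scale q b'" using essential_cycle_frobenius_dvd[OF b(1) q] ..
  \<comment> \<open>The same function \<open>y\<close> serves for \<open>U\<close>, since the two
    exponent complexes are equal.\<close>
  have ess: "essential_cycle (exponent_complex U b') i y"
    using b(1) exponent_complex_frobenius[OF U q] by (simp add: b')
  have "int (total_degree b') - int i \<le> regularity I"
    using regularity_ge[OF U ess] by (simp add: I_def)
  then have "int q * (int (total_degree b') - int i) \<le> int q * regularity I"
    by (rule mult_left_mono) simp
  \<comment> \<open>\<open>q > 0\<close> makes the factor \<open>int q - 1\<close> nonnegative, and
    the strict bound on \<open>i\<close> by the number of variables gives i \<le> n - 1.\<close>
  moreover have "(int q - 1) * int i \<le> (int q - 1) * (int CARD('n) - 1)"
    using essential_cycle_degree[OF ess] q by (intro mult_left_mono) auto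
  moreover have "regularity (bracket_power I q) = int q * (int (total_degree b') - int i) + (int q - 1) * int i"
    by (simp add: I_def bracket_power_supported_on b(2) b' total_degree_nat_scale algebra_simps)
  ultimately show "regularity (bracket_power I q) \<le> int q * regularity I + (int q - 1) * (int CARD('n) - 1)"
    by linarith
qed

theorem proposition2p11:
  fixes I :: "('n::{finite,linorder}, 'k::field) mpoly set" and q :: nat
  assumes "infinite (UNIV :: 'k set)"
    and "CARD('n) \<ge> 2"
    and "monomial_ideal I" and "I \<noteq> {0}" and "I \<noteq> UNIV"
    and "borel_type I"
    and "q > 0"
  shows "let n = real CARD('n);
             \<alpha> = 1 + (n - 1) / real_of_int (regularity I)
         in real_of_int (regularity (bracket_power I q))
              \<le> real q * real_of_int (regularity I) + (real q - 1) * (n - 1)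
          \<and> real q * real_of_int (regularity I) + (real q - 1) * (n - 1)
              = \<alpha> * real q * real_of_int (regularity I) - (n - 1)"
proof -
  obtain U where U: "\<And>m c. m \<in> U \<Longrightarrow> m + c \<in> U" and I: "I = supported_on U"
    using monomial_ideal_supported_on[OF assms(3)] by blast
  have "U \<noteq> {}" using assms(4) by (auto simp: I supported_on_def)
  moreover have "0 \<notin> U"
  proof
    assume "0 \<in> U"
    then have "m \<in> U" for m using U[of 0 m] by simp
    then have "U = UNIV" by blast
    then show False using assms(5) by (simp add: I)
  qed
  ultimately have reg: "regularity I \<ge> 1"
    "regularity (bracket_power I q) \<le> int q * regularity I + (int q - 1) * (int CARD('n) - 1)"
    using regularity_bracket_power[OF U _ _ assms(7), where ?'k='k] by (simp_all add: I)
  from reg(2) have "real_of_int (regularity (bracket_power I q))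
      \<le> real_of_int (int q * regularity I + (int q - 1) * (int CARD('n) - 1))"
    by (simp only: of_int_le_iff)
  \<comment> \<open>A regularity of at least 1 is nonzero, so it cancels against the denominator in
    \<alpha>; this gives the equality.\<close>
  then show ?thesis using reg(1) by (simp add: Let_def field_simps)
qed

end
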